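(* Let $\lambda$ be a negative real number with $\lambda\neq -1$. Let $M=\begin{pmatrix}A&B\\ C&A^T\end{pmatrix}\in\mathrm{Sp}(2n)$ be a Wonenburger matrix whose spectrum is contained in $\{\lambda,\lambda^{-1}\}$, and suppose that both $\lambda$ and $\lambda^{-1}$ have multiplicity $n$. Then $M$ has at least one real symplectic square root if and only if the half-dimension $n$ is even and $M\sim M_1^{\diamond 2}$ for some lower-dimensional Wonenburger matrix $M_1$ (i.e. $M_1\in\mathrm{Sp}(n)$).
   Context: $\mathrm{Sp}(2n)$ is the group of real $2n\times 2n$ matrices $M$ with $M^TJM=J$, where $J=\begin{pmatrix}0&-I_n\\ I_n&0\end{pmatrix}$. A Wonenburger matrix is a matrix $M=\begin{pmatrix}A&B\\ C&A^T\end{pmatrix}$ with $A,B,C$ real $n\times n$ matrices satisfying $B=B^T$, $C=C^T$, $AB=BA^T$, $A^TC=CA$, $A^2-BC=I$ (these relations ensure $M\in\mathrm{Sp}(2n)$). A real symplectic square root of $M\in\mathrm{Sp}(2n)$ is a matrix $X\in\mathrm{Sp}(2n)$ with $X^2=M$. For $2m_k\times 2m_k$ matrices in square block form $M_k=\begin{pmatrix}A_k&B_k\\ C_k&D_k\end{pmatrix}$, $k=1,2$, the $\diamond$-sum is the $2(m_1+m_2)\times 2(m_1+m_2)$ matrix $$M_1\diamond M_2=\begin{pmatrix}A_1&0&B_1&0\\ 0&A_2&0&B_2\\ C_1&0&D_1&0\\ 0&C_2&0&D_2\end{pmatrix},$$ and $M^{\diamond k}$ is the $k$-fold $\diamond$-sum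 of $M$ with itself. $M\sim N$ means $PMP^{-1}=N$ for some real symplectic matrix $P$. *)

theory Defs
  imports "Jordan_Normal_Form.Spectral_Radius"
begin

text \<open>
  Throughout, the index \<open>n\<close> is the half-dimension: a matrix of half-dimension \<open>n\<close> is a
  \<open>2n \<times> 2n\<close> matrix.
\<close>

definition J_mat :: "nat \<Rightarrow> real mat" where
  "J_mat n = four_block_mat (0\<^sub>m n n) (- 1\<^sub>m n) (1\<^sub>m n) (0\<^sub>m n n)"

definition Sp :: "nat \<Rightarrow> real mat set" where
  "Sp n = {M \<in> carrier_mat (2 * n) (2 * n). transpose_mat M * J_mat n * M = J_mat n}"

definition wonenburger :: "nat \<Rightarrow> real mat \<Rightarrow> bool" where
  "wonenburger n M \<longleftrightarrow>
    (\<exists>A B C. A \<in> carrier_mat n n \<and> B \<in> carrier_mat n n \<and> C \<in> carrier_mat n n \<and>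
       M = four_block_mat A B C (transpose_mat A) \<and>
       B = transpose_mat B \<and> C = transpose_mat C \<and>
       A * B = B * transpose_mat A \<and> transpose_mat A * C = C * A \<and>
       A * A - B * C = 1\<^sub>m n)"

definition symplectic_sqrt :: "nat \<Rightarrow> real mat \<Rightarrow> real mat \<Rightarrow> bool" where
  "symplectic_sqrt n M X \<longleftrightarrow> X \<in> Sp n \<and> X ^\<^sub>m 2 = M"

text \<open>
  \<open>similar_mat_wit N M P Q\<close> says that \<open>Q\<close> is the inverse of \<open>P\<close> and \<open>N = P * M * Q\<close>.
\<close>

definition symplectically_similar :: "nat \<Rightarrow> real mat \<Rightarrow> real mat \<Rightarrow> bool" where
  "symplectically_similar n M N \<longleftrightarrow> (\<exists>P\<in>Sp n. \<exists>Q. similar_mat_wit N M P Q)"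

definition diamond_sum :: "real mat \<Rightarrow> real mat \<Rightarrow> real mat"  (infixr \<open>\<diamondop>\<close> 65) where
  "M\<^sub>1 \<diamondop> M\<^sub>2 =
    (let m\<^sub>1 = dim_row M\<^sub>1 div 2;
         m\<^sub>2 = dim_row M\<^sub>2 div 2;
         (A\<^sub>1, B\<^sub>1, C\<^sub>1, D\<^sub>1) = split_block M\<^sub>1 m\<^sub>1 m\<^sub>1;
         (A\<^sub>2, B\<^sub>2, C\<^sub>2, D\<^sub>2) = split_block M\<^sub>2 m\<^sub>2 m\<^sub>2;
         dsum = (\<lambda>X Y. four_block_mat X (0\<^sub>m m\<^sub>1 m\<^sub>2) (0\<^sub>m m\<^sub>2 m\<^sub>1) Y)
     in four_block_mat (dsum A\<^sub>1 A\<^sub>2) (dsum B\<^sub>1 B\<^sub>2) (dsum C\<^sub>1 C\<^sub>2) (dsum D\<^sub>1 D\<^sub>2))"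

text \<open>The empty matrix is the neutral element of the diamond sum, hence the base case.\<close>

primrec diamond_power :: "real mat \<Rightarrow> nat \<Rightarrow> real mat" where
  "diamond_power M 0 = 0\<^sub>m 0 0"
| "diamond_power M (Suc k) = M \<diamondop> diamond_power M k"

lemma wonenburger_in_Sp:
  assumes "wonenburger n M"
  shows "M \<in> Sp n"
proof -
  obtain A B C where c: "A \<in> carrier_mat n n" "B \<in> carrier_mat n n" "C \<in> carrier_mat n n"
    and M: "M = four_block_mat A B C (transpose_mat A)"
    and r: "B = transpose_mat B" "C = transpose_mat C"
      "A * B = B * transpose_mat A" "transpose_mat A * C = C * A" "A * A - B * C = 1\<^sub>m n"
    using assms unfolding wonenburger_def by blast
  let ?T = "transpose_mat A"
  have cT: "?T \<in> carrier_mat n n" using c by simp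
  have MT: "transpose_mat M = four_block_mat ?T C B A"
    unfolding M using transpose_four_block_mat[OF c cT] r(1,2)[symmetric] by simp
  have z: "0\<^sub>m n n \<in> carrier_mat n n" "- 1\<^sub>m n \<in> carrier_mat n n" "(1\<^sub>m n :: real mat) \<in> carrier_mat n n"
    for n by auto
  have u: "- ?T \<in> carrier_mat n n" "- B \<in> carrier_mat n n"
    using c by auto
  have MJ: "transpose_mat M * J_mat n = four_block_mat C (- ?T) A (- B)"
    unfolding MT J_mat_def mult_four_block_mat[OF cT c(3) c(2) c(1) z(1) z(2) z(3) z(1)]
    using c cT by simp
  have tr: "?T * ?T - C * B = 1\<^sub>m n"
    using arg_cong[OF r(5), of transpose_mat] c r(1,2)[symmetric]
    by (simp add: transpose_minus[of _ n n] transpose_mult[of _ n n _ n])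
  have e1: "C * A + (- ?T) * C = 0\<^sub>m n n"
    using add_uminus_minus_mat[of "C * A" n n "C * A"] r(4) c by simp
  have e2: "C * B + (- ?T) * ?T = - 1\<^sub>m n"
  proof -
    have "C * B + (- ?T) * ?T = - (?T * ?T - C * B)"
      unfolding uminus_mult_left_mat by (rule eq_matI) (use c cT in auto)
    then show ?thesis unfolding tr .
  qed
  have e3: "A * A + (- B) * C = 1\<^sub>m n"
    using add_uminus_minus_mat[of "A * A" n n "B * C"] r(5) c by simp
  have e4: "A * B + (- B) * ?T = 0\<^sub>m n n"
    using add_uminus_minus_mat[of "A * B" n n "A * B"] r(3)[symmetric] c by simp
  have "transpose_mat M * J_mat n * M = J_mat n"
    unfolding MJ unfolding M J_mat_def
      mult_four_block_mat[OF c(3) u(1) c(1) u(2) c(1) c(2) c(3) cT] e1 e2 e3 e4 ..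
  moreover have "M \<in> carrier_mat (2 * n) (2 * n)"
    unfolding M mult_2 using c(1) cT by (rule four_block_carrier_mat)
  ultimately show ?thesis unfolding Sp_def by blast
qed

lemma diamond_sum_four_block_mat:
  assumes "A\<^sub>1 \<in> carrier_mat m m" "B\<^sub>1 \<in> carrier_mat m m" "C\<^sub>1 \<in> carrier_mat m m" "D\<^sub>1 \<in> carrier_mat m m"
    and "A\<^sub>2 \<in> carrier_mat k k" "B\<^sub>2 \<in> carrier_mat k k" "C\<^sub>2 \<in> carrier_mat k k" "D\<^sub>2 \<in> carrier_mat k k"
  shows "four_block_mat A\<^sub>1 B\<^sub>1 C\<^sub>1 D\<^sub>1 \<diamondop> four_block_mat A\<^sub>2 B\<^sub>2 C\<^sub>2 D\<^sub>2 =
    four_block_mat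
      (four_block_mat A\<^sub>1 (0\<^sub>m m k) (0\<^sub>m k m) A\<^sub>2) (four_block_mat B\<^sub>1 (0\<^sub>m m k) (0\<^sub>m k m) B\<^sub>2)
      (four_block_mat C\<^sub>1 (0\<^sub>m m k) (0\<^sub>m k m) C\<^sub>2) (four_block_mat D\<^sub>1 (0\<^sub>m m k) (0\<^sub>m k m) D\<^sub>2)"
proof -
  have split: "split_block (four_block_mat A B C D) l l = (A, B, C, D)"
    if "A \<in> carrier_mat l l" "B \<in> carrier_mat l l" "C \<in> carrier_mat l l" "D \<in> carrier_mat l l"
    for A B C D :: "real mat" and l
    using that by (auto simp: split_block_def Let_def intro!: eq_matI)
  have d: "dim_row (four_block_mat A\<^sub>1 B\<^sub>1 C\<^sub>1 D\<^sub>1) div 2 = m" "dim_row (four_block_mat A\<^sub>2 B\<^sub>2 C\<^sub>2 D\<^sub>2) div 2 = k"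
    using assms by auto
  show ?thesis
    unfolding diamond_sum_def d Let_def split[OF assms(1-4)] split[OF assms(5-8)] by simp
qed

lemma diamond_sum_empty:
  assumes "M \<in> carrier_mat (2 * m) (2 * m)"
  shows "M \<diamondop> 0\<^sub>m 0 0 = M"
proof -
  obtain A B C D where sp: "split_block M m m = (A, B, C, D)"
    by (cases "split_block M m m")
  have dims: "dim_row M = m + m" "dim_col M = m + m"
    using assms by auto
  note s = split_block[OF sp dims]
  have r: "four_block_mat X (0\<^sub>m m 0) (0\<^sub>m 0 m) (0\<^sub>m 0 0) = X"
    if "X \<in> carrier_mat m m" for X :: "real mat"
    by (rule eq_matI) (use that in auto)
  have e: "0\<^sub>m 0 0 = four_block_mat (0\<^sub>m 0 0) (0\<^sub>m 0 0) (0\<^sub>m 0 0) (0\<^sub>m 0 0 :: real mat)"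
    by (rule eq_matI) auto
  have z: "0\<^sub>m 0 0 \<in> carrier_mat 0 0" by simp
  have "four_block_mat A B C D \<diamondop> 0\<^sub>m 0 0 = four_block_mat A B C D"
    using diamond_sum_four_block_mat[OF s(1-4) z z z z, folded e]
    unfolding r[OF s(1)] r[OF s(2)] r[OF s(3)] r[OF s(4)] .
  then show ?thesis using s(5) by simp
qed

lemma diamond_power_two:
  assumes "M \<in> carrier_mat (2 * m) (2 * m)"
  shows "diamond_power M 2 = M \<diamondop> M"
  using diamond_sum_empty[OF assms] by (simp add: numeral_2_eq_2)

end

theory Submission
  imports Defs
begin

text \<open>
  Put \<open>\<mu> = (l + l\<^bsup>-1\<^esup>) / 2\<close> and \<open>s = (l - l\<^bsup>-1\<^esup>) / 2\<close>, so that \<open>\<mu> + s = l\<close> and \<open>\<mu> - s = l\<^bsup>-1\<^esup>\<close>. A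
  Wonenburger matrix \<open>M\<close> with blocks \<open>A\<close>, \<open>B\<close>, \<open>C\<close> satisfies \<open>M + M\<^bsup>-1\<^esup> = 2 diag(A, A\<^sup>T)\<close>. Hence the condition
  on the spectrum says that \<open>\<mu>\<close> is the only complex eigenvalue of \<open>A\<close>, and \<open>A\<close> is similar to a real
  Jordan matrix (\<open>wonenburger_spectrum_imp_jordan\<close>). As \<open>l \<noteq> - 1\<close> and \<open>l < 0\<close>, the number
  \<open>\<mu>\<^sup>2 - 1 = s\<^sup>2\<close> is positive. So \<open>BC = A\<^sup>2 - 1\<close> has an invertible square root \<open>p(A)\<close> that is a polynomial
  in \<open>A\<close> with \<open>p(\<mu>) = s\<close> (\<open>poly_square_root_mod_power\<close>), and \<open>M\<close> is symplectically similar to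
  \<open>diag(A + p(A), (A - p(A))\<^sup>T)\<close> (\<open>wonenburger_similar_hyp_mat\<close>). The first block has the only
  eigenvalue \<open>l\<close>, the second one is its inverse transposed, and up to symplectic similarity the result
  depends only on the similarity class of \<open>A\<close> (\<open>hyp_mat_similar\<close>).

  Suppose that \<open>M\<close> has a symplectic square root. It yields a real matrix \<open>Y\<close> that commutes with \<open>A\<close> and
  satisfies \<open>Y\<^sup>2 = A + p(A)\<close> (\<open>sqrt_hyp_mat_commutes\<close>). Each kernel of \<open>(A - \<mu>)\<^bsup>k\<^esup>\<close> is invariant under \<open>Y\<close>,
  and \<open>(det Y)\<^sup>2\<close> on it is \<open>l\<close> to the power of its dimension. Since \<open>l < 0\<close>, all these dimensions are
  even, so each Jordan block size occurs an even number of times (\<open>jordan_blocks_doubled\<close>) and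
  \<open>A\<close> is similar to \<open>a \<oplus> a\<close> for a Jordan matrix \<open>a\<close>. A symmetric matrix conjugates \<open>a\<close> to its transpose,
  which makes \<open>a\<close> the \<open>A\<close>-block of a Wonenburger matrix \<open>M\<^sub>1\<close>
  (\<open>wonenburger_blocks_of_symmetric_intertwiner\<close>). The double of \<open>M\<^sub>1\<close> is a Wonenburger matrix with \<open>A\<close>-block
  \<open>a \<oplus> a\<close>, so it has the same normal form as \<open>M\<close>.

  Conversely, let \<open>M\<close> be symplectically similar to the double of \<open>M\<^sub>1\<close>, and let \<open>a\<close> be the \<open>A\<close>-block of
  \<open>M\<^sub>1\<close>. Since \<open>- l > 0\<close>, there is a polynomial \<open>k\<close> with \<open>k(a)\<^sup>2 = - (a + p(a))\<close>, and the block matrix with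
  rows \<open>(0, - k(a))\<close> and \<open>(k(a), 0)\<close> is a square root of the first block of the normal form. Completing
  it by its inverse transposed gives the symplectic root (\<open>sqrt_hyp_matI\<close>).
\<close>

section \<open>Evaluation of polynomials at a square matrix\<close>

lemmas square_mat_simps =
  assoc_mult_mat[of _ n n _ n _ n]
  add_mult_distrib_mat[of _ n n _ _ n] mult_add_distrib_mat[of _ n n _ n]
  minus_mult_distrib_mat[of _ n n _ _ n] mult_minus_distrib_mat[of _ n n _ n]
  mult_smult_assoc_mat[of _ n n _ n] mult_smult_distrib[of _ n n _ n] for n

definition mat_poly :: "real poly \<Rightarrow> real mat \<Rightarrow> real mat" where
  "mat_poly p A =
    fold_coeffs (\<lambda>a M. a \<cdot>\<^sub>m 1\<^sub>m (dim_row A) + A * M) p (0\<^sub>m (dim_row A) (dim_row A))"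

lemma mat_poly_0:
  assumes "A \<in> carrier_mat n n"
  shows "mat_poly 0 A = 0\<^sub>m n n"
  using assms by (simp add: mat_poly_def)

lemma mat_poly_pCons:
  assumes "A \<in> carrier_mat n n"
  shows "mat_poly (pCons a p) A = a \<cdot>\<^sub>m 1\<^sub>m n + A * mat_poly p A"
proof (cases "p = 0 \<and> a = 0")
  case True
  then show ?thesis using assms by (auto simp: mat_poly_def intro!: eq_matI)
next
  case False
  then consider "p \<noteq> 0" | "a \<noteq> 0" by blast
  then show ?thesis
    using assms unfolding mat_poly_def
    by cases (simp_all add: fold_coeffs_pCons_not_0_0_eq fold_coeffs_pCons_coeff_not_0_eq)
qed

lemma mat_poly_dim [simp]: "dim_row (mat_poly p A) = dim_row A" "dim_col (mat_poly p A) = dim_row A"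
proof -
  have "dim_row (mat_poly p A) = dim_row A \<and> dim_col (mat_poly p A) = dim_row A"
  proof (induction p)
    case 0
    then show ?case by (simp add: mat_poly_def)
  next
    case (pCons a p)
    then consider "p \<noteq> 0" | "a \<noteq> 0" by blast
    then show ?case
      using pCons.IH unfolding mat_poly_def
      by cases (simp_all add: fold_coeffs_pCons_not_0_0_eq fold_coeffs_pCons_coeff_not_0_eq)
  qed
  then show "dim_row (mat_poly p A) = dim_row A" "dim_col (mat_poly p A) = dim_row A" by auto
qed

lemma mat_poly_carrier:
  assumes "A \<in> carrier_mat n n"
  shows "mat_poly p A \<in> carrier_mat n n"
  using assms by auto

lemma mat_poly_add:
  assumes A: "A \<in> carrier_mat n n"
  shows "mat_poly (p + q) A = mat_poly p A + mat_poly q A"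
proof (induction p q rule: poly_induct2)
  case 0
  then show ?case using A by (simp add: mat_poly_0)
next
  case (pCons a p b q)
  have c: "mat_poly p A \<in> carrier_mat n n" "mat_poly q A \<in> carrier_mat n n"
    using mat_poly_carrier[OF A] by blast+
  have "(a + b) \<cdot>\<^sub>m 1\<^sub>m n + (X + Y) = (a \<cdot>\<^sub>m 1\<^sub>m n + X) + (b \<cdot>\<^sub>m 1\<^sub>m n + Y)"
    if "X \<in> carrier_mat n n" "Y \<in> carrier_mat n n" for X Y
    using that by (intro eq_matI) (auto simp: algebra_simps)
  then show ?case
    using A c by (simp add: mat_poly_pCons[OF A] pCons.IH mult_add_distrib_mat[OF A c])
qed

lemma mat_poly_smult:
  assumes A: "A \<in> carrier_mat n n"
  shows "mat_poly (Polynomial.smult c p) A = c \<cdot>\<^sub>m mat_poly p A"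
proof (induction p)
  case 0
  then show ?case using A by (auto simp: mat_poly_0)
next
  case (pCons a p)
  have "A * (c \<cdot>\<^sub>m mat_poly p A) = c \<cdot>\<^sub>m (A * mat_poly p A)"
    using mult_smult_distrib[OF A mat_poly_carrier[OF A]] .
  moreover have "(c * a) \<cdot>\<^sub>m 1\<^sub>m n + c \<cdot>\<^sub>m X = c \<cdot>\<^sub>m (a \<cdot>\<^sub>m 1\<^sub>m n + X)"
    if "X \<in> carrier_mat n n" for X
    using that by (intro eq_matI) (auto simp: algebra_simps)
  ultimately show ?case
    using A by (simp add: mat_poly_pCons[OF A] pCons.IH mult_carrier_mat[OF A mat_poly_carrier[OF A]])
qed

lemma mat_poly_mult:
  assumes A: "A \<in> carrier_mat n n"
  shows "mat_poly (p * q) A = mat_poly p A * mat_poly q A"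
proof (induction p)
  case 0
  then show ?case using A by (simp add: mat_poly_0 left_mult_zero_mat[of _ n n])
next
  case (pCons a p)
  let ?P = "mat_poly p A" and ?Q = "mat_poly q A"
  have c: "?P \<in> carrier_mat n n" "?Q \<in> carrier_mat n n" using mat_poly_carrier[OF A] by blast+
  have "(a \<cdot>\<^sub>m 1\<^sub>m n + A * ?P) * ?Q = a \<cdot>\<^sub>m ?Q + A * (?P * ?Q)"
    using A c by (simp add: square_mat_simps[where n = n])
  moreover have "0 \<cdot>\<^sub>m 1\<^sub>m n + X = X" if "X \<in> carrier_mat n n" for X :: "real mat"
    using that by (intro eq_matI) auto
  ultimately show ?case
    using A c by (simp add: mat_poly_pCons[OF A] mat_poly_add[OF A] mat_poly_smult[OF A] pCons.IH)
qed

lemma mat_poly_const: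
  assumes A: "A \<in> carrier_mat n n"
  shows "mat_poly [:c:] A = c \<cdot>\<^sub>m 1\<^sub>m n"
  using A by (auto simp: mat_poly_pCons mat_poly_0 intro!: eq_matI)

lemma mat_poly_1:
  assumes A: "A \<in> carrier_mat n n"
  shows "mat_poly 1 A = 1\<^sub>m n"
  using mat_poly_const[OF A, of 1] by (auto simp: one_pCons intro!: eq_matI)

lemma mat_poly_X:
  assumes A: "A \<in> carrier_mat n n"
  shows "mat_poly [:0, 1:] A = A"
  using A by (auto simp: mat_poly_pCons mat_poly_0 intro!: eq_matI)

lemma mat_poly_diff:
  assumes A: "A \<in> carrier_mat n n"
  shows "mat_poly (p - q) A = mat_poly p A - mat_poly q A"
proof -
  have "mat_poly (p - q) A = mat_poly (p + Polynomial.smult (- 1) q) A" by simp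
  also have "\<dots> = mat_poly p A + (- 1) \<cdot>\<^sub>m mat_poly q A"
    using mat_poly_add[OF A] mat_poly_smult[OF A] by metis
  finally show ?thesis
    using mat_poly_carrier[OF A, of p] mat_poly_carrier[OF A, of q]
    by (auto intro!: eq_matI)
qed

text \<open>
  Each commutation relation needed for polynomials in a matrix is an instance of this lemma: with
  \<open>K = A\<close> it says that \<open>A\<close> commutes with \<open>p(A)\<close>, and with \<open>A' = A\<^sup>T\<close> it carries the relations
  between the blocks of a Wonenburger matrix over to \<open>p(A)\<close>.
\<close>

lemma mat_poly_intertwine:
  assumes A: "A \<in> carrier_mat n n" and A': "A' \<in> carrier_mat n n" and K: "K \<in> carrier_mat n n"
    and KA: "K * A = A' * K"
  shows "K * mat_poly p A = mat_poly p A' * K"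
proof (induction p)
  case 0
  then show ?case using A A' K by (simp add: mat_poly_0)
next
  case (pCons a p)
  let ?P = "mat_poly p A" and ?P' = "mat_poly p A'"
  have c: "?P \<in> carrier_mat n n" "?P' \<in> carrier_mat n n" using mat_poly_carrier[OF A] mat_poly_carrier[OF A'] by blast+
  have "K * (A * ?P) = A' * (?P' * K)"
  proof -
    have "K * (A * ?P) = (K * A) * ?P" using A K c by (simp add: square_mat_simps[where n = n])
    also have "\<dots> = A' * (K * ?P)" using A' K c by (simp add: KA)
    also have "\<dots> = A' * (?P' * K)" by (simp add: pCons.IH)
    finally show ?thesis .
  qed
  then show ?case
    using A A' K c
    by (simp add: mat_poly_pCons[OF A] mat_poly_pCons[OF A'] square_mat_simps[where n = n])
qed

lemma mat_poly_commute:
  assumes A: "A \<in> carrier_mat n n"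
  shows "mat_poly p A * mat_poly q A = mat_poly q A * mat_poly p A"
  by (metis A mat_poly_mult mult.commute)

lemma mat_poly_transpose:
  assumes A: "A \<in> carrier_mat n n"
  shows "mat_poly p (transpose_mat A) = transpose_mat (mat_poly p A)"
proof (induction p)
  case 0
  then show ?case using A by (simp add: mat_poly_0[of _ n])
next
  case (pCons a p)
  have T: "transpose_mat A \<in> carrier_mat n n" using A by simp
  have P: "mat_poly p A \<in> carrier_mat n n" by (rule mat_poly_carrier[OF A])
  have "transpose_mat (a \<cdot>\<^sub>m 1\<^sub>m n + A * mat_poly p A) = a \<cdot>\<^sub>m 1\<^sub>m n + transpose_mat (A * mat_poly p A)"
    using A P by (intro eq_matI) auto
  also have "transpose_mat (A * mat_poly p A) = transpose_mat A * mat_poly p (transpose_mat A)"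
    unfolding mat_poly_intertwine[OF A A A refl] pCons.IH by (rule transpose_mult[OF P A])
  finally show ?case using A T by (simp add: mat_poly_pCons[of _ n])
qed

lemma mat_poly_diag_block:
  assumes A: "A \<in> carrier_mat n n" and B: "B \<in> carrier_mat m m"
  shows "mat_poly p (four_block_mat A (0\<^sub>m n m) (0\<^sub>m m n) B) =
    four_block_mat (mat_poly p A) (0\<^sub>m n m) (0\<^sub>m m n) (mat_poly p B)"
proof (induction p)
  case 0
  then show ?case using A B by (simp add: mat_poly_0[of _ n] mat_poly_0[of _ m] mat_poly_0[of _ "n + m"])
next
  case (pCons a p)
  have F: "four_block_mat A (0\<^sub>m n m) (0\<^sub>m m n) B \<in> carrier_mat (n + m) (n + m)"
    using A B by simp
  have c: "mat_poly p A \<in> carrier_mat n n" "mat_poly p B \<in> carrier_mat m m"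
    using mat_poly_carrier[OF A] mat_poly_carrier[OF B] by blast+
  have "four_block_mat A (0\<^sub>m n m) (0\<^sub>m m n) B *
      four_block_mat (mat_poly p A) (0\<^sub>m n m) (0\<^sub>m m n) (mat_poly p B) =
    four_block_mat (A * mat_poly p A) (0\<^sub>m n m) (0\<^sub>m m n) (B * mat_poly p B)"
    using A B c by (subst mult_four_block_mat[of _ n n _ m _ m _ _ n _ m]) auto
  then show ?case
    unfolding mat_poly_pCons[OF F] mat_poly_pCons[OF A] mat_poly_pCons[OF B] pCons.IH
    using A B c by (auto intro!: eq_matI)
qed

lemma mat_poly_upper_triangular:
  assumes A: "A \<in> carrier_mat n n" and ut: "\<And>i j. i < n \<Longrightarrow> j < i \<Longrightarrow> A $$ (i, j) = 0"
  shows "(\<forall>i<n. mat_poly p A $$ (i, i) = poly p (A $$ (i, i))) \<and>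
    (\<forall>i<n. \<forall>j<i. mat_poly p A $$ (i, j) = 0)"
proof (induction p)
  case 0
  then show ?case using A by (simp add: mat_poly_0)
next
  case (pCons a p)
  let ?P = "mat_poly p A"
  have P: "?P \<in> carrier_mat n n" by (rule mat_poly_carrier[OF A])
  have e: "(A * ?P) $$ (i, j) = (\<Sum>k<n. A $$ (i, k) * ?P $$ (k, j))" if "i < n" "j < n" for i j
    using that A P by (auto simp: scalar_prod_def lessThan_atLeast0 intro!: sum.cong)
  have "(A * ?P) $$ (i, i) = A $$ (i, i) * poly p (A $$ (i, i))" if i: "i < n" for i
  proof -
    have "(\<Sum>k<n. A $$ (i, k) * ?P $$ (k, i)) = (\<Sum>k\<in>{i}. A $$ (i, k) * ?P $$ (k, i))"
    proof (rule sum.mono_neutral_right)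
      show "\<forall>k\<in>{..<n} - {i}. A $$ (i, k) * ?P $$ (k, i) = 0"
        using ut[OF i] pCons.IH i by (metis DiffE lessThan_iff linorder_neqE_nat mult_eq_0_iff singletonI)
    qed (use i in auto)
    then show ?thesis using e[OF i i] pCons.IH i by simp
  qed
  moreover have "(A * ?P) $$ (i, j) = 0" if i: "i < n" and j: "j < i" for i j
  proof -
    have "A $$ (i, k) * ?P $$ (k, j) = 0" if "k < n" for k
      using ut[OF i, of k] pCons.IH that j by (cases "k < i") auto
    then have "(\<Sum>k<n. A $$ (i, k) * ?P $$ (k, j)) = 0" by (intro sum.neutral) simp
    then show ?thesis using e[of i j] i j by simp
  qed
  ultimately show ?case using A P by (auto simp: mat_poly_pCons)
qed

section \<open>Square roots and inverses modulo a power of a linear polynomial\<close>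

text \<open>
  Hensel lifting: as \<open>f\<close> has a nonzero square as its value at \<open>c\<close>, it has a square root in the
  formal power series in \<open>x - c\<close>. For a matrix \<open>A\<close> with the only eigenvalue \<open>c\<close> it makes \<open>p(A)\<close> a
  square root of \<open>f(A)\<close>.
\<close>

lemma poly_square_root_mod_power:
  fixes f :: "real poly"
  assumes "poly f c = s ^ 2" and s: "s \<noteq> 0"
  shows "\<exists>p. poly p c = s \<and> [:- c, 1:] ^ Suc n dvd p ^ 2 - f"
proof (induction n)
  case 0
  have "poly ([:s:] ^ 2 - f) c = 0" using assms(1) by simp
  then have "[:- c, 1:] ^ Suc 0 dvd [:s:] ^ 2 - f" unfolding poly_eq_0_iff_dvd by simp
  then show ?case by (intro exI[of _ "[:s:]"]) simp
next
  case (Suc n)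
  let ?u = "[:- c, 1:] ^ Suc n"
  obtain p r where p: "poly p c = s" and r: "p ^ 2 - f = ?u * r"
    using Suc.IH unfolding dvd_def by blast
  \<comment> \<open>Newton correction: \<open>a\<close> cancels the value at \<open>c\<close> of the cofactor left by \<open>p\<close>.\<close>
  define a where "a = - poly r c / (2 * s)"
  define q where "q = r + [:a:] * p + [:a:] * p + [:a:] ^ 2 * ?u"
  have "poly q c = 0"
    using p s by (simp add: q_def a_def field_simps)
  then have "[:- c, 1:] dvd q" by (simp add: poly_eq_0_iff_dvd)
  then have "?u * [:- c, 1:] dvd ?u * q" by (rule mult_dvd_mono[OF dvd_refl])
  also have "?u * q = (p + [:a:] * ?u) ^ 2 - f"
  proof -
    have "(p + b * u) ^ 2 - f = (p ^ 2 - f) + u * (b * p + b * p + b ^ 2 * u)" for b u :: "real poly"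
      by (simp add: power2_eq_square algebra_simps)
    then show ?thesis unfolding r q_def by (simp only: algebra_simps)
  qed
  finally show ?case
    using p by (intro exI[of _ "p + [:a:] * ?u"]) (simp add: mult.commute)
qed

text \<open>
  A polynomial that does not vanish at \<open>c\<close> is a unit modulo each power of \<open>x - c\<close>, by the same
  lifting. For a matrix \<open>A\<close> with the only eigenvalue \<open>c\<close> it makes \<open>q(A)\<close> the inverse of \<open>p(A)\<close>.
\<close>

lemma poly_inverse_mod_power:
  fixes p :: "real poly"
  assumes p: "poly p c \<noteq> 0"
  shows "\<exists>q. [:- c, 1:] ^ n dvd p * q - 1"
proof (induction n)
  case 0
  show ?case by simp
next
  case (Suc n)
  let ?u = "[:- c, 1:] ^ n"
  obtain q r where r: "p * q - 1 = ?u * r" using Suc.IH unfolding dvd_def by blast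
  define a where "a = - poly r c / poly p c"
  have "poly (r + [:a:] * p) c = 0" using p by (simp add: a_def)
  then have "[:- c, 1:] dvd r + [:a:] * p" unfolding poly_eq_0_iff_dvd .
  then have "?u * [:- c, 1:] dvd ?u * (r + [:a:] * p)" by (rule mult_dvd_mono[OF dvd_refl])
  also have "?u * (r + [:a:] * p) = p * (q + [:a:] * ?u) - 1"
  proof -
    have "p * (q + b * u) - 1 = (p * q - 1) + u * (b * p)" for b u
      by (simp add: algebra_simps)
    then show ?thesis unfolding r by (simp only: distrib_left)
  qed
  finally show ?case by (intro exI[of _ "q + [:a:] * ?u"]) (simp add: mult.commute)
qed

text \<open>
  Each factor \<open>J - c\<close> is strictly upper triangular and pushes the support of the product one diagonal
  further up.
\<close>

lemma mat_poly_pow_shift_entry: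
  assumes J: "J \<in> carrier_mat n n"
    and ut: "\<And>i j. i < n \<Longrightarrow> j < i \<Longrightarrow> J $$ (i, j) = 0" and d: "\<And>i. i < n \<Longrightarrow> J $$ (i, i) = c"
  shows "i < n \<Longrightarrow> j < n \<Longrightarrow> j < i + k \<Longrightarrow> mat_poly ([:- c, 1:] ^ k) J $$ (i, j) = 0"
proof (induction k arbitrary: i)
  case 0
  then show ?case using J by (simp add: mat_poly_1)
next
  case (Suc k)
  let ?N = "mat_poly [:- c, 1:] J" and ?P = "mat_poly ([:- c, 1:] ^ k) J"
  have N: "?N $$ (i, m) = 0" if "m < n" "m \<le> i" for m
    using mat_poly_upper_triangular[OF J ut, of "[:- c, 1:]"] d[OF \<open>i < n\<close>] that \<open>i < n\<close>
    by (cases "m = i") auto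
  have "mat_poly ([:- c, 1:] ^ Suc k) J $$ (i, j) = (\<Sum>m\<in>{0..<n}. ?N $$ (i, m) * ?P $$ (m, j))"
    unfolding power_Suc mat_poly_mult[OF J] using J Suc.prems by (simp add: scalar_prod_def)
  also have "\<dots> = 0"
  proof (rule sum.neutral, rule ballI)
    fix m assume "m \<in> {0..<n}"
    then show "?N $$ (i, m) * ?P $$ (m, j) = 0"
      using N[of m] Suc.IH[of m] Suc.prems by (cases "m \<le> i") auto
  qed
  finally show ?case .
qed

text \<open>
  This is what Cayley and Hamilton give for a single eigenvalue, stated so that congruences between
  polynomials modulo \<open>(x - c)\<^sup>n\<close> become identities between matrices.
\<close>

lemma mat_poly_eq_0_if_similar:
  assumes J: "J \<in> carrier_mat n n"
    and ut: "\<And>i j. i < n \<Longrightarrow> j < i \<Longrightarrow> J $$ (i, j) = 0" and d: "\<And>i. i < n \<Longrightarrow> J $$ (i, i) = c"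
    and sim: "similar_mat A J" and dvd: "[:- c, 1:] ^ n dvd q"
  shows "mat_poly q A = 0\<^sub>m n n"
proof -
  obtain P Q where w: "similar_mat_wit A J P Q" using sim unfolding similar_mat_def by blast
  have A: "A \<in> carrier_mat n n"
    using similar_mat_witD2(4)[OF J similar_mat_wit_sym[OF w]] similar_mat_witD2(5)[OF J similar_mat_wit_sym[OF w]] by blast
  note w = similar_mat_witD2[OF A w]
  have "mat_poly ([:- c, 1:] ^ n) J = 0\<^sub>m n n"
    using mat_poly_pow_shift_entry[OF J ut d, of _ _ n] J by (intro eq_matI) auto
  moreover obtain r where "q = [:- c, 1:] ^ n * r" using dvd by blast
  ultimately have 0: "mat_poly q J = 0\<^sub>m n n"
    using J mat_poly_carrier[OF J, of r] by (simp add: mat_poly_mult[OF J] left_mult_zero_mat[of _ n n])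
  \<comment> \<open>The equation \<open>q(J) = 0\<close> is carried over to \<open>A\<close> by the change of basis.\<close>
  have "P * J = A * P"
    using w by (simp add: square_mat_simps[where n = n])
  then have "P * mat_poly q J = mat_poly q A * P"
    by (rule mat_poly_intertwine[OF J A w(6)])
  then have "mat_poly q A * P = 0\<^sub>m n n"
    using w(6) by (simp add: 0)
  then have "mat_poly q A * (P * Q) = 0\<^sub>m n n"
    using w mat_poly_carrier[OF A, of q] assoc_mult_mat[of "mat_poly q A" n n P n Q n] by simp
  then show ?thesis unfolding w(1) right_mult_one_mat[OF mat_poly_carrier[OF A]] .
qed

section \<open>Jordan matrices with one real eigenvalue\<close>

definition jordan :: "real \<Rightarrow> nat list \<Rightarrow> real mat" where
  "jordan \<mu> ks = jordan_matrix (map (\<lambda>k. (k, \<mu>)) ks)"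

lemma jordan_dim [simp]: "dim_row (jordan \<mu> ks) = sum_list ks" "dim_col (jordan \<mu> ks) = sum_list ks"
  unfolding jordan_def by (simp_all add: o_def)

lemma jordan_carrier: "jordan \<mu> ks \<in> carrier_mat (sum_list ks) (sum_list ks)"
  by auto

lemma jordan_append: "jordan \<mu> (ks @ ms) =
    four_block_mat (jordan \<mu> ks) (0\<^sub>m (sum_list ks) (sum_list ms))
      (0\<^sub>m (sum_list ms) (sum_list ks)) (jordan \<mu> ms)"
proof -
  have j: "jordan \<mu> ks = diag_block_mat (map (\<lambda>k. jordan_block k \<mu>) ks)" for ks
    unfolding jordan_def jordan_matrix_def by (simp add: o_def)
  show ?thesis
    unfolding j map_append diag_block_mat_append Let_def
    unfolding jordan_dim(1)[of \<mu>, unfolded j] jordan_dim(2)[of \<mu>, unfolded j] ..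
qed

lemma jordan_singleton: "jordan \<mu> [k] = jordan_block k \<mu>"
  by (rule eq_matI) (simp_all add: jordan_def jordan_matrix_def)

lemma jordan_Cons: "jordan \<mu> (k # ks) =
    four_block_mat (jordan_block k \<mu>) (0\<^sub>m k (sum_list ks)) (0\<^sub>m (sum_list ks) k) (jordan \<mu> ks)"
  using jordan_append[of \<mu> "[k]" ks] by (simp add: jordan_singleton)

text \<open>
  The basis vector with index \<open>i\<close> lies in the kernel of \<open>(J - \<mu>)\<^bsup>h+1\<^esup>\<close>, but not of \<open>(J - \<mu>)\<^bsup>h\<^esup>\<close>,
  where \<open>h\<close> is entry \<open>i\<close> of this list: its offset from the start of its block.
\<close>

definition heights :: "nat list \<Rightarrow> nat list" where
  "heights ks = concat (map (\<lambda>k. [0..<k]) ks)"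

lemma heights_Nil [simp]: "heights [] = []" by (simp add: heights_def)

lemma heights_Cons [simp]: "heights (k # ks) = [0..<k] @ heights ks" by (simp add: heights_def)

lemma length_heights [simp]: "length (heights ks) = sum_list ks"
  by (induction ks) simp_all

lemma heights_pred:
  "j < sum_list ks \<Longrightarrow> heights ks ! j \<noteq> 0 \<Longrightarrow> j \<noteq> 0 \<and> heights ks ! j = Suc (heights ks ! (j - 1))"
proof (induction ks arbitrary: j)
  case (Cons k ks)
  show ?case
  proof (cases "j < k")
    case True
    then show ?thesis using Cons.prems by (auto simp: nth_append)
  next
    case False
    have "heights ks ! (j - k) \<noteq> 0" using False Cons.prems by (simp add: nth_append)
    with Cons.IH[of "j - k"] False Cons.prems
    have "j - k \<noteq> 0" "heights ks ! (j - k) = Suc (heights ks ! (j - k - 1))" by auto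
    then show ?thesis using False by (auto simp: nth_append)
  qed
qed simp

lemma jordan_entry:
  "i < sum_list ks \<Longrightarrow> j < sum_list ks \<Longrightarrow>
    jordan \<mu> ks $$ (i, j) = (if i = j then \<mu> else if j = Suc i \<and> heights ks ! j \<noteq> 0 then 1 else 0)"
proof (induction ks arbitrary: i j)
  case (Cons k ks)
  show ?case
  proof (cases "k \<le> i \<and> k \<le> j")
    case True
    then obtain a b where ab: "i = k + a" "j = k + b" by (metis le_Suc_ex)
    have "jordan \<mu> (k # ks) $$ (i, j) = jordan \<mu> ks $$ (a, b)"
      using Cons.prems by (simp add: ab jordan_Cons)
    moreover have "heights (k # ks) ! j = heights ks ! b"
      by (simp add: ab nth_append)
    ultimately show ?thesis
      using Cons.IH[of a b] Cons.prems by (simp add: ab)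
  next
    case False
    have 0: "heights ks ! 0 = 0" if "sum_list ks > 0"
      using heights_pred[of 0 ks] that by auto
    show ?thesis
    proof (cases "i < k \<and> j < k")
      case True
      then show ?thesis by (auto simp: jordan_Cons nth_append)
    next
      case nt: False
      have "heights (k # ks) ! j = 0" if "j = Suc i"
      proof -
        have "j = k" using that False nt by auto
        then show ?thesis using 0 Cons.prems by (simp add: nth_append)
      qed
      then show ?thesis using Cons.prems False nt by (auto simp: jordan_Cons)
    qed
  qed
qed simp

lemma card_heights_less: "card {i. i < sum_list ks \<and> heights ks ! i < k} = (\<Sum>x\<leftarrow>ks. min k x)"
proof -
  have "length (filter (\<lambda>x. x < k) (heights ks)) = (\<Sum>x\<leftarrow>ks. min k x)"
  proof (induction ks)
    case (Cons a ks)
    have "length (filter (\<lambda>x. x < k) [0..<a]) = min k a"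
      by (induction a) auto
    then show ?case using Cons by simp
  qed simp
  then show ?thesis by (simp add: length_filter_conv_card)
qed

lemma similar_mat_block_swap:
  fixes A B :: "real mat"
  assumes A: "A \<in> carrier_mat n n" and B: "B \<in> carrier_mat m m"
  shows "similar_mat (four_block_mat A (0\<^sub>m n m) (0\<^sub>m m n) B) (four_block_mat B (0\<^sub>m m n) (0\<^sub>m n m) A)"
proof -
  let ?P = "four_block_mat (0\<^sub>m n m) (1\<^sub>m n) (1\<^sub>m m) (0\<^sub>m m n) :: real mat"
  let ?Q = "four_block_mat (0\<^sub>m m n) (1\<^sub>m m) (1\<^sub>m n) (0\<^sub>m n m) :: real mat"
  let ?A = "four_block_mat A (0\<^sub>m n m) (0\<^sub>m m n) B"
  let ?B = "four_block_mat B (0\<^sub>m m n) (0\<^sub>m n m) A"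
  have PQ: "?P * ?Q = 1\<^sub>m (n + m)"
    by (subst mult_four_block_mat[of _ n m _ n _ m _ _ n _ m]) auto
  have QP: "?Q * ?P = 1\<^sub>m (n + m)"
    by (subst mult_four_block_mat[of _ m n _ m _ n _ _ m _ n]) (auto simp: add.commute)
  have "?P * ?B = four_block_mat (0\<^sub>m n m) A B (0\<^sub>m m n)"
    using A B by (subst mult_four_block_mat[of _ n m _ n _ m _ _ m _ n]) auto
  also have "\<dots> * ?Q = ?A"
    using A B by (subst mult_four_block_mat[of _ n m _ n _ m _ _ n _ m]) auto
  finally have "?A = ?P * ?B * ?Q" by simp
  moreover have "{?A, ?B, ?P, ?Q} \<subseteq> carrier_mat (n + m) (n + m)"
    using A B by (auto simp: add.commute)
  ultimately show ?thesis using similar_matI[OF _ PQ _] QP by blast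
qed

lemma jordan_permute:
  "mset ks = mset ms \<Longrightarrow> similar_mat (jordan \<mu> ks) (jordan \<mu> ms)"
proof (induction ks arbitrary: ms)
  case Nil
  then show ?case by (auto intro: similar_mat_refl[OF jordan_carrier])
next
  case (Cons k ks)
  have "k \<in> set ms" using Cons.prems by (metis list.set_intros(1) mset_eq_setD)
  then obtain us vs where ms: "ms = us @ k # vs" by (meson split_list)
  have "similar_mat (jordan \<mu> ks) (jordan \<mu> (us @ vs))"
    using Cons.IH[of "us @ vs"] Cons.prems by (simp add: ms)
  moreover have "sum_list ks = sum_list (us @ vs)"
    using Cons.prems by (metis add_mset_add_mset_same_iff ms mset.simps(2) mset_append sum_mset_sum_list union_mset_add_mset_right)
  ultimately have "similar_mat (jordan \<mu> (k # ks)) (jordan \<mu> (k # (us @ vs)))"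
    unfolding jordan_Cons
    using similar_mat_four_block_0_0[OF similar_mat_refl[OF jordan_block_carrier] _ jordan_block_carrier jordan_carrier]
    by metis
  moreover have "similar_mat (jordan \<mu> (k # (us @ vs))) (jordan \<mu> ms)"
  proof -
    have "similar_mat (jordan \<mu> ([k] @ us)) (jordan \<mu> (us @ [k]))"
      unfolding jordan_append by (rule similar_mat_block_swap[OF jordan_carrier jordan_carrier])
    from similar_mat_four_block_0_0[OF this similar_mat_refl[OF jordan_carrier] jordan_carrier jordan_carrier]
    have "similar_mat (jordan \<mu> (([k] @ us) @ vs)) (jordan \<mu> ((us @ [k]) @ vs))"
      unfolding jordan_append[of \<mu> "[k] @ us" vs] jordan_append[of \<mu> "us @ [k]" vs]
      by (simp add: add.commute)
    then show ?thesis by (simp add: ms)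
  qed
  ultimately show ?case by (rule similar_mat_trans)
qed

text \<open>
  A Jordan block is persymmetric, so reversing the order of its basis transposes it.
\<close>

lemma jordan_symmetric_intertwiner:
  "\<exists>S. S \<in> carrier_mat (sum_list ks) (sum_list ks) \<and> transpose_mat S = S \<and> S * S = 1\<^sub>m (sum_list ks) \<and>
    jordan \<mu> ks * S = S * transpose_mat (jordan \<mu> ks)"
proof (induction ks)
  case Nil
  show ?case by (intro exI[of _ "1\<^sub>m 0"]) auto
next
  case (Cons k ks)
  let ?n = "sum_list ks" and ?J = "jordan \<mu> ks" and ?B = "jordan_block k \<mu>"
  obtain S where S: "S \<in> carrier_mat ?n ?n" "transpose_mat S = S" "S * S = 1\<^sub>m ?n" "?J * S = S * transpose_mat ?J"
    using Cons.IH by blast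
  \<comment> \<open>\<open>F\<close> reverses the basis of one block.\<close>
  define F where "F = (mat k k (\<lambda>(i, j). if i + j + 1 = k then 1 else 0) :: real mat)"
  have F: "F \<in> carrier_mat k k" "transpose_mat F = F" by (auto simp: F_def add.commute)
  have FX: "(X * F) $$ (i, j) = X $$ (i, k - 1 - j)" if "X \<in> carrier_mat k k" "i < k" "j < k" for X i j
  proof -
    have "(X * F) $$ (i, j) = (\<Sum>m\<in>{0..<k}. if m = k - 1 - j then X $$ (i, m) else 0)"
    proof -
      have "(X * F) $$ (i, j) = (\<Sum>m\<in>{0..<k}. X $$ (i, m) * F $$ (m, j))"
        using that F(1) by (simp add: scalar_prod_def)
      also have "\<dots> = (\<Sum>m\<in>{0..<k}. if m = k - 1 - j then X $$ (i, m) else 0)"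
        using that by (intro sum.cong) (auto simp: F_def)
      finally show ?thesis .
    qed
    then show ?thesis using that by simp
  qed
  have FF: "F * F = 1\<^sub>m k"
    using F FX[OF F(1)] by (intro eq_matI) (auto simp: F_def)
  have BF: "?B * F = F * transpose_mat ?B"
  proof -
    have "transpose_mat (?B * F) = ?B * F"
      using F FX[OF jordan_block_carrier] by (intro eq_matI) auto
    then show ?thesis using transpose_mult[OF jordan_block_carrier F(1)] F(2) by simp
  qed
  let ?S = "four_block_mat F (0\<^sub>m k ?n) (0\<^sub>m ?n k) S"
  have "?S \<in> carrier_mat (k + ?n) (k + ?n)" using F S by simp
  moreover have "transpose_mat ?S = ?S"
    using F S by (subst transpose_four_block_mat) auto
  moreover have "?S * ?S = 1\<^sub>m (k + ?n)"
    using F S FF by (subst mult_four_block_mat[of _ k k _ ?n _ ?n _ _ k _ ?n]) auto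
  moreover have "jordan \<mu> (k # ks) * ?S = ?S * transpose_mat (jordan \<mu> (k # ks))"
  proof -
    have c: "?B \<in> carrier_mat k k" "?J \<in> carrier_mat ?n ?n" by auto
    have "jordan \<mu> (k # ks) * ?S = four_block_mat (?B * F) (0\<^sub>m k ?n) (0\<^sub>m ?n k) (?J * S)"
      unfolding jordan_Cons
      using F S c by (subst mult_four_block_mat[of _ k k _ ?n _ ?n _ _ k _ ?n]) auto
    moreover have "?S * transpose_mat (jordan \<mu> (k # ks)) =
        four_block_mat (F * transpose_mat ?B) (0\<^sub>m k ?n) (0\<^sub>m ?n k) (S * transpose_mat ?J)"
      unfolding jordan_Cons transpose_four_block_mat[OF c(1) zero_carrier_mat zero_carrier_mat c(2)] zero_transpose_mat
      using F S c by (subst mult_four_block_mat[of _ k k _ ?n _ ?n _ _ k _ ?n]) auto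
    ultimately show ?thesis by (simp add: BF S(4))
  qed
  ultimately show ?case by (intro exI[of _ ?S]) simp
qed

section \<open>Real square roots for a negative eigenvalue\<close>

lemma even_multiplicities_imp_doubled:
  assumes "\<And>a. even (count (mset xs) a)"
  shows "\<exists>ys. mset xs = mset (ys @ ys)"
  using assms
proof (induction "length xs" arbitrary: xs rule: less_induct)
  case less
  show ?case
  proof (cases xs)
    case Nil
    then show ?thesis by (intro exI[of _ "[]"]) simp
  next
    case (Cons a zs)
    have "odd (count (mset zs) a)" using less.prems[of a] Cons by simp
    then have "a \<in> set zs" by (metis count_mset_0_iff even_zero)
    then obtain us vs where zs: "zs = us @ a # vs" by (meson split_list)
    have "even (count (mset (us @ vs)) b)" for b
      using less.prems[of b] by (auto simp: Cons zs split: if_splits)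
    then obtain ys where "mset (us @ vs) = mset (ys @ ys)"
      using less.hyps[of "us @ vs"] by (auto simp: Cons zs)
    then show ?thesis by (intro exI[of _ "a # ys"]) (simp add: Cons zs)
  qed
qed

text \<open>
  The sum of \<open>min k x\<close> over the block sizes is the dimension of the kernel of \<open>(J - \<mu>)\<^bsup>k\<^esup>\<close>, and its
  second difference in \<open>k\<close> counts the blocks of a given size. The size 0 escapes the count.
\<close>

lemma even_min_sums_imp_doubled:
  fixes xs :: "nat list"
  assumes "\<And>k. even (\<Sum>x\<leftarrow>xs. min k x)" and pos: "0 \<notin> set xs"
  shows "\<exists>ys. mset xs = mset (ys @ ys)"
proof (rule even_multiplicities_imp_doubled)
  fix a :: nat
  show "even (count (mset xs) a)"
  proof (cases a)
    case 0
    then have "count (mset xs) a = 0" using pos by (metis count_mset_0_iff)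
    then show ?thesis by (simp only: even_zero)
  next
    case (Suc b)
    \<comment> \<open>Second difference of \<open>k \<mapsto> min k x\<close>: it is concave with its only kink at \<open>x\<close>.\<close>
    have "(\<Sum>x\<leftarrow>zs. min (Suc b) x) + (\<Sum>x\<leftarrow>zs. min (Suc b) x) =
        (\<Sum>x\<leftarrow>zs. min b x) + (\<Sum>x\<leftarrow>zs. min (Suc (Suc b)) x) + count (mset zs) (Suc b)" for zs
      by (induction zs) (auto simp: min_def)
    moreover have "even d" if "a + a = b + c + d" "even b" "even c" for a b c d :: nat
      using that by presburger
    ultimately show ?thesis using assms(1) unfolding Suc by blast
  qed
qed

text \<open>
  The coordinates with \<open>h i < k\<close> span the kernel \<open>W\<close> of \<open>(J - \<mu>)\<^bsup>k\<^esup>\<close>. It is invariant under \<open>Y\<close> because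
  \<open>Y\<close> commutes with \<open>J\<close>, and \<open>(det Y)\<^sup>2 = d\<^bsup>dim W\<^esup>\<close> for the restriction of \<open>Y\<close> to \<open>W\<close>. As \<open>d\<close> is negative,
  the dimension is even.
\<close>

lemma even_card_of_negative_triangular_square:
  fixes \<mu> d :: real and Y :: "real mat"
  assumes J: "J \<in> carrier_mat n n" and Y: "Y \<in> carrier_mat n n" and comm: "Y * J = J * Y"
    and J_entry: "\<And>i j. i < n \<Longrightarrow> j < n \<Longrightarrow>
      J $$ (i, j) = (if i = j then \<mu> else if j = Suc i \<and> h j \<noteq> 0 then 1 else 0)"
    and h: "\<And>j. j < n \<Longrightarrow> h j \<noteq> 0 \<Longrightarrow> j \<noteq> 0 \<and> h j = Suc (h (j - 1))"
    and ut: "\<And>i j. i < n \<Longrightarrow> j < i \<Longrightarrow> (Y * Y) $$ (i, j) = 0"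
    and diag: "\<And>i. i < n \<Longrightarrow> (Y * Y) $$ (i, i) = d" and d: "d < 0"
  shows "even (card {i. i < n \<and> h i < (k :: nat)})"
proof -
  have YJ: "(Y * J) $$ (i, j) = \<mu> * Y $$ (i, j) + (if h j \<noteq> 0 then Y $$ (i, j - 1) else 0)"
    if i: "i < n" and j: "j < n" for i j
  proof -
    have "(Y * J) $$ (i, j) = (\<Sum>m\<in>{0..<n}. Y $$ (i, m) * J $$ (m, j))"
      using i j J Y by (simp add: scalar_prod_def)
    also have "\<dots> = (\<Sum>m\<in>{0..<n}. (if m = j then \<mu> * Y $$ (i, m) else 0) +
        (if m = j - 1 then if h j \<noteq> 0 then Y $$ (i, m) else 0 else 0))"
      using j h[OF j] by (intro sum.cong) (auto simp: J_entry)
    also have "\<dots> = \<mu> * Y $$ (i, j) + (if h j \<noteq> 0 then Y $$ (i, j - 1) else 0)"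
      using j by (simp add: sum.distrib)
    finally show ?thesis .
  qed
  have JY: "(J * Y) $$ (i, j) = \<mu> * Y $$ (i, j) +
      (if Suc i < n \<and> h (Suc i) \<noteq> 0 then Y $$ (Suc i, j) else 0)"
    if i: "i < n" and j: "j < n" for i j
  proof -
    have "(J * Y) $$ (i, j) = (\<Sum>m\<in>{0..<n}. J $$ (i, m) * Y $$ (m, j))"
      using i j J Y by (simp add: scalar_prod_def)
    also have "\<dots> = (\<Sum>m\<in>{0..<n}. (if m = i then \<mu> * Y $$ (m, j) else 0) +
        (if m = Suc i then if h (Suc i) \<noteq> 0 then Y $$ (m, j) else 0 else 0))"
      using i by (intro sum.cong) (auto simp: J_entry)
    also have "\<dots> = \<mu> * Y $$ (i, j) + (if Suc i < n \<and> h (Suc i) \<noteq> 0 then Y $$ (Suc i, j) else 0)"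
      using i by (simp add: sum.distrib)
    finally show ?thesis .
  qed
  \<comment> \<open>Comparing \<open>Y * J\<close> with \<open>J * Y\<close> one row higher moves a nonzero entry to smaller heights.\<close>
  have Y0: "Y $$ (i, j) = 0" if "i < n" "j < n" "h j < h i" for i j
    using that
  proof (induction "h j" arbitrary: i j rule: less_induct)
    case less
    have hi: "i \<noteq> 0" "h i = Suc (h (i - 1))" using h[OF less.prems(1)] less.prems(3) by auto
    have "(Y * J) $$ (i - 1, j) = (J * Y) $$ (i - 1, j)" by (simp add: comm)
    then have "Y $$ (i, j) = (if h j \<noteq> 0 then Y $$ (i - 1, j - 1) else 0)"
      using YJ[of "i - 1" j] JY[of "i - 1" j] less.prems hi by simp
    moreover have "Y $$ (i - 1, j - 1) = 0" if "h j \<noteq> 0"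
      using less.hyps[of "j - 1" "i - 1"] h[OF less.prems(2) that] less.prems hi by simp
    ultimately show ?case by simp
  qed
  \<comment> \<open>\<open>Z\<close> is \<open>Y\<close> on the coordinates of height below \<open>k\<close> and the identity on the others.\<close>
  define Z where "Z = mat n n (\<lambda>(i, j). if h j < k then Y $$ (i, j) else if i = j then 1 else 0)"
  have Z: "Z \<in> carrier_mat n n" by (simp add: Z_def)
  have ZZ: "(Z * Z) $$ (i, j) = (if h j < k then (Y * Y) $$ (i, j) else if i = j then 1 else 0)"
    if i: "i < n" and j: "j < n" for i j
  proof (cases "h j < k")
    case True
    have "Z $$ (i, m) * Z $$ (m, j) = Y $$ (i, m) * Y $$ (m, j)" if "m < n" for m
      using i j that True Y0[of m j] by (cases "h m < k") (auto simp: Z_def)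
    then show ?thesis using i j Z Y True by (simp add: scalar_prod_def)
  next
    case False
    have "Z $$ (i, m) * Z $$ (m, j) = (if m = j then Z $$ (i, j) else 0)" if "m < n" for m
      using j that False by (auto simp: Z_def)
    then have "(Z * Z) $$ (i, j) = (\<Sum>m\<in>{0..<n}. if m = j then Z $$ (i, j) else 0)"
      using i j Z by (simp add: scalar_prod_def)
    then show ?thesis using i j False by (simp add: Z_def)
  qed
  have ut': "upper_triangular (Z * Z)"
    unfolding upper_triangular_def using Z ut by (auto simp: ZZ simp del: index_mult_mat(1))
  have "det Z ^ 2 = det (Z * Z)"
    by (simp add: det_mult[OF Z Z] power2_eq_square)
  also have "\<dots> = prod_list (diag_mat (Z * Z))"
    by (rule det_upper_triangular[OF ut' mult_carrier_mat[OF Z Z]])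
  also have "\<dots> = (\<Prod>i\<in>{0..<n}. (Z * Z) $$ (i, i))"
    unfolding prod_list_diag_prod using Z by simp
  also have "\<dots> = (\<Prod>i\<in>{0..<n}. if h i < k then d else 1)"
    using diag by (intro prod.cong) (auto simp: ZZ simp del: index_mult_mat(1))
  also have "\<dots> = d ^ card {i. i < n \<and> h i < k}"
    by (simp add: prod.If_cases Int_def)
  finally have "d ^ card {i. i < n \<and> h i < k} \<ge> 0"
    using zero_le_power2[of "det Z"] by metis
  then show ?thesis using d by (simp add: zero_le_power_eq)
qed

text \<open>
  The obstruction to a real square root of \<open>p(J)\<close>, whose only eigenvalue \<open>p(\<mu>)\<close> is negative. A root
  that commutes with \<open>J\<close> acts on the kernels of all powers of \<open>J - \<mu>\<close>, so their dimensions are even,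
  and they determine the block sizes.
\<close>

lemma jordan_blocks_doubled:
  fixes \<mu> :: real
  assumes pos: "0 \<notin> set ks"
    and Y: "Y \<in> carrier_mat (sum_list ks) (sum_list ks)" and comm: "Y * jordan \<mu> ks = jordan \<mu> ks * Y"
    and YY: "Y * Y = mat_poly p (jordan \<mu> ks)" and neg: "poly p \<mu> < 0"
  shows "\<exists>ms. mset ks = mset (ms @ ms)"
proof (rule even_min_sums_imp_doubled[OF _ pos])
  fix k
  let ?n = "sum_list ks" and ?J = "jordan \<mu> ks"
  have "\<forall>i<?n. mat_poly p ?J $$ (i, i) = poly p (?J $$ (i, i))"
    "\<forall>i<?n. \<forall>j<i. mat_poly p ?J $$ (i, j) = 0"
    using mat_poly_upper_triangular[OF jordan_carrier[of \<mu> ks], of p] by (auto simp: jordan_entry)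
  then have "even (card {i. i < ?n \<and> heights ks ! i < k})"
    using jordan_entry[of _ ks _ \<mu>]
    by (intro even_card_of_negative_triangular_square[OF jordan_carrier Y comm, of \<mu> _ "poly p \<mu>"])
      (use heights_pred neg in \<open>auto simp: YY simp del: index_mult_mat(1)\<close>)
  then show "even (\<Sum>x\<leftarrow>ks. min k x)" by (simp add: card_heights_less)
qed

section \<open>Symplectic matrices and symplectic similarity\<close>

lemma J_mat_carrier: "J_mat n \<in> carrier_mat (2 * n) (2 * n)"
  unfolding J_mat_def mult_2 by (rule four_block_carrier_mat) auto

lemma J_mat_square: "J_mat n * J_mat n = - 1\<^sub>m (2 * n)"
proof -
  have "J_mat n * J_mat n = four_block_mat (- 1\<^sub>m n) (0\<^sub>m n n) (0\<^sub>m n n) (- 1\<^sub>m n)"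
    unfolding J_mat_def by (subst mult_four_block_mat[of _ n n _ n _ n _ _ n _ n]) auto
  also have "\<dots> = - 1\<^sub>m (2 * n)" by (rule eq_matI) auto
  finally show ?thesis .
qed

lemma Sp_carrier: "P \<in> Sp n \<Longrightarrow> P \<in> carrier_mat (2 * n) (2 * n)"
  by (simp add: Sp_def)

lemma Sp_blockI:
  assumes c: "A \<in> carrier_mat n n" "B \<in> carrier_mat n n" "C \<in> carrier_mat n n" "D \<in> carrier_mat n n"
    and "transpose_mat A * C = transpose_mat C * A"
    and "transpose_mat B * D = transpose_mat D * B"
    and "transpose_mat A * D - transpose_mat C * B = 1\<^sub>m n"
  shows "four_block_mat A B C D \<in> Sp n"
proof -
  let ?M = "four_block_mat A B C D"
  let ?A = "transpose_mat A" and ?B = "transpose_mat B" and ?C = "transpose_mat C" and ?D = "transpose_mat D"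
  have ct: "?A \<in> carrier_mat n n" "?B \<in> carrier_mat n n" "?C \<in> carrier_mat n n" "?D \<in> carrier_mat n n"
    using c by auto
  have adj: "?D * A - ?B * C = 1\<^sub>m n"
    using arg_cong[OF assms(7), of transpose_mat] c ct
    by (simp add: transpose_minus[of _ n n] transpose_mult[of _ n n _ n])
  have "transpose_mat ?M * J_mat n = four_block_mat ?C (- ?A) ?D (- ?B)"
    unfolding transpose_four_block_mat[OF c] J_mat_def
    using ct by (subst mult_four_block_mat[of _ n n _ n _ n _ _ n _ n]) auto
  also have "\<dots> * ?M = four_block_mat (?C * A + (- ?A) * C) (?C * B + (- ?A) * D)
      (?D * A + (- ?B) * C) (?D * B + (- ?B) * D)"
    using c ct by (subst mult_four_block_mat[of _ n n _ n _ n _ _ n _ n]) auto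
  also have "?C * A + (- ?A) * C = 0\<^sub>m n n"
    using c ct by (simp add: assms(5) add_uminus_minus_mat[of _ n n])
  also have "?D * B + (- ?B) * D = 0\<^sub>m n n"
    using c ct by (simp add: assms(6) add_uminus_minus_mat[of _ n n])
  also have "?D * A + (- ?B) * C = 1\<^sub>m n"
    using c ct add_uminus_minus_mat[of "?D * A" n n "?B * C"] by (simp add: adj)
  also have "?C * B + (- ?A) * D = - (?A * D - ?C * B)"
    using c ct by (intro eq_matI) auto
  finally have "transpose_mat ?M * J_mat n * ?M = J_mat n"
    unfolding assms(7) J_mat_def .
  moreover have "?M \<in> carrier_mat (2 * n) (2 * n)"
    unfolding mult_2 using c(1,4) by (rule four_block_carrier_mat)
  ultimately show ?thesis by (simp add: Sp_def)
qed

lemma Sp_mult: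
  assumes "P \<in> Sp n" "Q \<in> Sp n"
  shows "P * Q \<in> Sp n"
proof -
  let ?N = "2 * n"
  have c: "P \<in> carrier_mat ?N ?N" "Q \<in> carrier_mat ?N ?N" "transpose_mat P \<in> carrier_mat ?N ?N"
    "transpose_mat Q \<in> carrier_mat ?N ?N" "J_mat n \<in> carrier_mat ?N ?N"
    using assms J_mat_carrier by (auto simp: Sp_def)
  have "transpose_mat (P * Q) * J_mat n * (P * Q) =
      transpose_mat Q * (transpose_mat P * J_mat n * P) * Q"
    using c by (simp add: transpose_mult[OF c(1,2)] square_mat_simps[where n = ?N])
  then show ?thesis using assms c by (simp add: Sp_def)
qed

text \<open>
  Solving \<open>P\<^sup>T J P = J\<close> for the inverse of \<open>P\<close> gives \<open>- J P\<^sup>T J\<close>.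
\<close>

lemma Sp_inverse:
  assumes P: "P \<in> Sp n"
  obtains Q where "Q \<in> Sp n" "P * Q = 1\<^sub>m (2 * n)" "Q * P = 1\<^sub>m (2 * n)"
proof -
  let ?N = "2 * n" and ?J = "J_mat n"
  have c: "P \<in> carrier_mat ?N ?N" "transpose_mat P \<in> carrier_mat ?N ?N" "?J \<in> carrier_mat ?N ?N"
    using P J_mat_carrier by (auto simp: Sp_def)
  have P': "transpose_mat P * (?J * P) = ?J"
    using P c by (simp add: Sp_def square_mat_simps[where n = ?N])
  define Q where "Q = - (?J * (transpose_mat P * ?J))"
  have Q: "Q \<in> carrier_mat ?N ?N" using c by (auto simp: Q_def)
  have QP: "Q * P = 1\<^sub>m ?N"
    unfolding Q_def uminus_mult_left_mat using c
    by (simp add: square_mat_simps[where n = ?N] P' J_mat_square)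
  have PQ: "P * Q = 1\<^sub>m ?N" by (rule mat_mult_left_right_inverse[OF Q c(1) QP])
  have "transpose_mat Q * ?J * Q = transpose_mat Q * (transpose_mat P * (?J * P)) * Q"
    by (simp add: P')
  also have "\<dots> = transpose_mat (P * Q) * ?J * (P * Q)"
    using c Q by (simp add: transpose_mult[OF c(1) Q] square_mat_simps[where n = ?N])
  also have "\<dots> = ?J" using c by (simp add: PQ)
  finally have "Q \<in> Sp n" using Q by (simp add: Sp_def)
  then show thesis using PQ QP by (rule that)
qed

lemma symplectically_similarI:
  assumes P: "P \<in> Sp n" and M: "M \<in> carrier_mat (2 * n) (2 * n)" and N: "N \<in> carrier_mat (2 * n) (2 * n)"
    and MP: "M * P = P * N"
  shows "symplectically_similar n M N"
proof -
  obtain Q where Q: "Q \<in> Sp n" "P * Q = 1\<^sub>m (2 * n)" "Q * P = 1\<^sub>m (2 * n)"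
    using Sp_inverse[OF P] .
  note c = Sp_carrier[OF P] Sp_carrier[OF Q(1)]
  have "Q * M * P = Q * P * N"
    using c M N MP by (simp add: square_mat_simps[where n = "2 * n"])
  then have "similar_mat_wit N M Q P"
    using c M N Q by (intro similar_mat_witI[of _ _ "2 * n"]) simp_all
  then show ?thesis using Q(1) unfolding symplectically_similar_def by blast
qed

text \<open>
  The inverse of a symplectic matrix is symplectic, so both witnesses of the similarity are.
\<close>

lemma symplectically_similarE:
  assumes "symplectically_similar n M N"
  obtains P Q where "P \<in> Sp n" "Q \<in> Sp n" "similar_mat_wit N M P Q"
proof -
  obtain P Q where P: "P \<in> Sp n" and w: "similar_mat_wit N M P Q"
    using assms unfolding symplectically_similar_def by blast
  obtain R where R: "R \<in> Sp n" "P * R = 1\<^sub>m (2 * n)" "R * P = 1\<^sub>m (2 * n)"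
    using Sp_inverse[OF P] .
  have d: "dim_row N = 2 * n"
    using similar_mat_witD(6)[OF refl w] Sp_carrier[OF P] by (metis carrier_matD(1))
  note w' = similar_mat_witD[OF d[symmetric] w]
  have "Q = Q * (P * R)" unfolding R(2) using w'(7) by simp
  also have "\<dots> = (Q * P) * R"
    using w'(6,7) Sp_carrier[OF R(1)] by (simp add: square_mat_simps[where n = "2 * n"])
  also have "\<dots> = R" unfolding w'(2) using Sp_carrier[OF R(1)] by simp
  finally show thesis using that P R(1) w by blast
qed

lemma symplectically_similar_sym:
  assumes "symplectically_similar n M N"
  shows "symplectically_similar n N M"
proof -
  obtain P Q where "Q \<in> Sp n" "similar_mat_wit N M P Q"
    using symplectically_similarE[OF assms] .
  then show ?thesis
    unfolding symplectically_similar_def by (meson similar_mat_wit_sym)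
qed

lemma symplectically_similar_trans:
  assumes "symplectically_similar n L M" "symplectically_similar n M N"
  shows "symplectically_similar n L N"
proof -
  obtain P Q P' Q' where "P \<in> Sp n" "similar_mat_wit M L P Q" "P' \<in> Sp n" "similar_mat_wit N M P' Q'"
    using assms unfolding symplectically_similar_def by blast
  then have "P' * P \<in> Sp n" "similar_mat_wit N L (P' * P) (Q * Q')"
    using Sp_mult similar_mat_wit_trans[of N M P' Q' L P Q] by simp_all
  then show ?thesis unfolding symplectically_similar_def by blast
qed

lemma pow_mat_2:
  assumes "X \<in> carrier_mat n n"
  shows "X ^\<^sub>m 2 = X * X"
  using assms by (simp add: numeral_2_eq_2)

lemma symplectic_sqrt_transfer:
  assumes "symplectically_similar n M N" and X: "symplectic_sqrt n M X"
  shows "\<exists>X'. symplectic_sqrt n N X'"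
proof -
  let ?N = "2 * n"
  obtain P Q where PQ: "P \<in> Sp n" "Q \<in> Sp n" and w: "similar_mat_wit N M P Q"
    using symplectically_similarE[OF assms(1)] .
  have X: "X \<in> Sp n" "X * X = M"
    using X Sp_carrier[of X n] unfolding symplectic_sqrt_def by (auto simp: pow_mat_2)
  note c = Sp_carrier[OF PQ(1)] Sp_carrier[OF PQ(2)] Sp_carrier[OF X(1)]
  have d: "?N = dim_row N" using similar_mat_witD(6)[OF refl w] c(1) by (metis carrier_matD(1))
  note w' = similar_mat_witD[OF d w]
  have "(P * X * Q) * (P * X * Q) = P * X * (Q * P) * X * Q"
    using c by (simp add: square_mat_simps[where n = ?N])
  also have "\<dots> = N"
    unfolding w'(2,3) using c by (simp add: X(2)[symmetric] square_mat_simps[where n = ?N])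
  finally have "(P * X * Q) * (P * X * Q) = N" .
  moreover have "P * X * Q \<in> Sp n" using PQ X by (simp add: Sp_mult)
  ultimately have "symplectic_sqrt n N (P * X * Q)"
    using pow_mat_2[OF Sp_carrier] by (simp add: symplectic_sqrt_def)
  then show ?thesis ..
qed

section \<open>Blocks of Wonenburger matrices\<close>

text \<open>
  The block form of the relations, needed because the arguments refer to the block \<open>A\<close> and not
  only to the assembled matrix.
\<close>

definition wonenburger_blocks :: "nat \<Rightarrow> real mat \<Rightarrow> real mat \<Rightarrow> real mat \<Rightarrow> bool" where
  "wonenburger_blocks n A B C \<longleftrightarrow>
    A \<in> carrier_mat n n \<and> B \<in> carrier_mat n n \<and> C \<in> carrier_mat n n \<and>
    B = transpose_mat B \<and> C = transpose_mat C \<and>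
    A * B = B * transpose_mat A \<and> transpose_mat A * C = C * A \<and> A * A - B * C = 1\<^sub>m n"

lemma wonenburger_blocksD:
  assumes "wonenburger_blocks n A B C"
  shows "A \<in> carrier_mat n n" "B \<in> carrier_mat n n" "C \<in> carrier_mat n n"
    "B = transpose_mat B" "C = transpose_mat C"
    "A * B = B * transpose_mat A" "transpose_mat A * C = C * A" "A * A - B * C = 1\<^sub>m n"
  using assms unfolding wonenburger_blocks_def by blast+

lemma wonenburger_iff_blocks:
  "wonenburger n M \<longleftrightarrow>
    (\<exists>A B C. wonenburger_blocks n A B C \<and> M = four_block_mat A B C (transpose_mat A))"
  unfolding wonenburger_def wonenburger_blocks_def by ((rule iff_exI)+, blast)

text \<open>
  Doubling a Wonenburger matrix doubles its \<open>A\<close>-block, and this block alone determines the normal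
  form.
\<close>

lemma wonenburger_blocks_diamond:
  assumes "wonenburger_blocks m A B C"
  defines "dbl \<equiv> \<lambda>X. four_block_mat X (0\<^sub>m m m) (0\<^sub>m m m) X"
  shows "wonenburger_blocks (m + m) (dbl A) (dbl B) (dbl C)"
    and "diamond_power (four_block_mat A B C (transpose_mat A)) 2 =
      four_block_mat (dbl A) (dbl B) (dbl C) (transpose_mat (dbl A))"
proof -
  let ?T = "transpose_mat A"
  have c: "A \<in> carrier_mat m m" "B \<in> carrier_mat m m" "C \<in> carrier_mat m m" "?T \<in> carrier_mat m m"
    and sym: "transpose_mat B = B" "transpose_mat C = C"
    and rel: "A * B = B * ?T" "?T * C = C * A" "A * A - B * C = 1\<^sub>m m"
    using assms(1) unfolding wonenburger_blocks_def by auto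
  have carr: "dbl X \<in> carrier_mat (m + m) (m + m)" if "X \<in> carrier_mat m m" for X
    unfolding dbl_def using that by (intro four_block_carrier_mat)
  have mult: "dbl X * dbl Y = dbl (X * Y)" if "X \<in> carrier_mat m m" "Y \<in> carrier_mat m m" for X Y
    unfolding dbl_def using that by (subst mult_four_block_mat[of _ m m _ m _ m _ _ m _ m]) auto
  have transp: "transpose_mat (dbl X) = dbl (transpose_mat X)" if "X \<in> carrier_mat m m" for X
    unfolding dbl_def using that by (subst transpose_four_block_mat) auto
  have minus: "dbl X - dbl Y = dbl (X - Y)" if "X \<in> carrier_mat m m" "Y \<in> carrier_mat m m" for X Y
    unfolding dbl_def using that by (intro eq_matI) auto
  have one: "dbl (1\<^sub>m m) = 1\<^sub>m (m + m)" by (simp add: dbl_def)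
  show "wonenburger_blocks (m + m) (dbl A) (dbl B) (dbl C)"
    unfolding wonenburger_blocks_def
  proof (intro conjI)
    have "dbl A * dbl A - dbl B * dbl C = dbl (A * A - B * C)"
      using c minus[OF mult_carrier_mat[OF c(1,1)] mult_carrier_mat[OF c(2,3)]] by (simp add: mult)
    then show "dbl A * dbl A - dbl B * dbl C = 1\<^sub>m (m + m)" unfolding rel(3) one .
  qed (use c carr in \<open>simp_all add: transp mult sym rel\<close>)
  have "four_block_mat A B C ?T \<in> carrier_mat (2 * m) (2 * m)"
    unfolding mult_2 by (rule four_block_carrier_mat[OF c(1,4)])
  then have "diamond_power (four_block_mat A B C ?T) 2 =
      four_block_mat A B C ?T \<diamondop> four_block_mat A B C ?T"
    by (rule diamond_power_two)
  also have "\<dots> = four_block_mat (dbl A) (dbl B) (dbl C) (dbl ?T)"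
    unfolding dbl_def by (rule diamond_sum_four_block_mat[OF c c])
  finally show "diamond_power (four_block_mat A B C ?T) 2 =
      four_block_mat (dbl A) (dbl B) (dbl C) (transpose_mat (dbl A))"
    by (simp add: transp c)
qed

text \<open>
  Each matrix that is conjugate to its transpose by a symmetric involution, and for which \<open>A\<^sup>2 - 1\<close> has a square
  root \<open>p(A)\<close>, is the \<open>A\<close>-block of a Wonenburger matrix.
\<close>

lemma wonenburger_blocks_of_symmetric_intertwiner:
  assumes A: "A \<in> carrier_mat n n" and S: "S \<in> carrier_mat n n" "transpose_mat S = S" "S * S = 1\<^sub>m n"
    and AS: "A * S = S * transpose_mat A"
    and p: "mat_poly (p * p - ([:0, 1:] * [:0, 1:] - 1)) A = 0\<^sub>m n n"
  shows "wonenburger_blocks n A (mat_poly p A * S) (S * mat_poly p A)"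
proof -
  define b where "b = mat_poly p A"
  let ?A = "transpose_mat A" and ?b = "transpose_mat b"
  have b: "b \<in> carrier_mat n n" unfolding b_def by (rule mat_poly_carrier[OF A])
  have t: "?A \<in> carrier_mat n n" "?b \<in> carrier_mat n n" using A b by auto
  note ring = square_mat_simps[where n = n]
  have SS: "S * (S * X) = X" if "X \<in> carrier_mat n n" for X
    using that S assoc_mult_mat[OF S(1,1) that] by simp
  have bS: "b * S = S * ?b"
    unfolding b_def mat_poly_transpose[OF A, symmetric]
    by (rule mat_poly_intertwine[OF t(1) A S(1) AS[symmetric], symmetric])
  have Ab: "A * b = b * A"
    unfolding b_def by (rule mat_poly_intertwine[OF A A A refl])
  have Sb: "S * b = ?b * S"
  proof -
    have "?b * S = S * (S * ?b) * S" using S t SS by simp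
    also have "\<dots> = S * (b * S) * S" by (simp add: bS)
    also have "\<dots> = S * b" using S b by (simp add: ring)
    finally show ?thesis ..
  qed
  have SA: "S * A = ?A * S"
  proof -
    have "?A * S = S * (S * ?A) * S" using S t SS by simp
    also have "\<dots> = S * (A * S) * S" by (simp add: AS)
    also have "\<dots> = S * A" using S A by (simp add: ring)
    finally show ?thesis ..
  qed
  have "wonenburger_blocks n A (b * S) (S * b)"
    unfolding wonenburger_blocks_def
  proof (intro conjI)
    show "b * S = transpose_mat (b * S)" unfolding transpose_mult[OF b S(1)] unfolding S(2) by (rule bS)
    show "S * b = transpose_mat (S * b)" unfolding transpose_mult[OF S(1) b] unfolding S(2) by (rule Sb)
    have "A * (b * S) = (A * b) * S" using A b S by (simp add: ring)
    also have "\<dots> = b * (A * S)" unfolding Ab using A b S by (simp add: ring)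
    also have "\<dots> = b * S * ?A" unfolding AS using t b S by (simp add: ring)
    finally show "A * (b * S) = b * S * ?A" .
    have "?A * (S * b) = (?A * S) * b" using t b S by (simp add: ring)
    also have "\<dots> = S * (A * b)" unfolding SA[symmetric] using A b S by (simp add: ring)
    also have "\<dots> = S * b * A" unfolding Ab using A b S by (simp add: ring)
    finally show "?A * (S * b) = S * b * A" .
    have bb: "b * S * (S * b) = b * b" using b S SS by (simp add: ring)
    have 0: "b * b - (A * A - 1\<^sub>m n) = 0\<^sub>m n n"
      using p unfolding mat_poly_diff[OF A] mat_poly_mult[OF A] mat_poly_X[OF A] mat_poly_1[OF A] b_def .
    show "A * A - b * S * (S * b) = 1\<^sub>m n"
      unfolding bb
    proof (rule eq_matI)
      fix i j assume "i < dim_row (1\<^sub>m n :: real mat)" "j < dim_col (1\<^sub>m n :: real mat)"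
      then have ij: "i < n" "j < n" by auto
      have "(b * b - (A * A - 1\<^sub>m n)) $$ (i, j) = 0" unfolding 0 using ij by simp
      then show "(A * A - b * b) $$ (i, j) = 1\<^sub>m n $$ (i, j)" using A b ij by (simp del: index_mult_mat(1))
    qed (use A b in auto)
  qed (use A b S in auto)
  then show ?thesis unfolding b_def .
qed

section \<open>The split normal form of a Wonenburger matrix\<close>

text \<open>
  For \<open>p(A)\<^sup>2 = A\<^sup>2 - 1\<close> the matrices \<open>A + p(A)\<close> and \<open>A - p(A)\<close> are inverse to each other, so
  this is a symplectic matrix that preserves the two coordinate Lagrangian subspaces. It serves as the
  normal form of a Wonenburger matrix.
\<close>

definition hyp_mat :: "real poly \<Rightarrow> real mat \<Rightarrow> real mat" where
  "hyp_mat p A = four_block_mat (mat_poly ([:0, 1:] + p) A) (0\<^sub>m (dim_row A) (dim_row A))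
    (0\<^sub>m (dim_row A) (dim_row A)) (transpose_mat (mat_poly ([:0, 1:] - p) A))"

lemma hyp_mat_carrier:
  assumes "A \<in> carrier_mat n n"
  shows "hyp_mat p A \<in> carrier_mat (2 * n) (2 * n)"
  unfolding hyp_mat_def mult_2 using assms by (intro four_block_carrier_mat) auto

text \<open>
  A change of basis \<open>R\<close> of the first Lagrangian subspace extends to the symplectic matrix
  \<open>diag(R, R\<^bsup>-T\<^esup>)\<close>.
\<close>

lemma hyp_mat_similar:
  assumes A: "A \<in> carrier_mat n n" and sim: "similar_mat A A'"
  shows "symplectically_similar n (hyp_mat p A) (hyp_mat p A')"
proof -
  obtain R R' where "similar_mat_wit A A' R R'" using sim unfolding similar_mat_def by blast
  note w = similar_mat_witD2[OF A this]
  let ?f = "[:0, 1:] + p" and ?g = "[:0, 1:] - p"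
  let ?Z = "0\<^sub>m n n :: real mat" and ?T = "transpose_mat R'"
  have c: "mat_poly ?f A \<in> carrier_mat n n" "mat_poly ?g A \<in> carrier_mat n n"
    "mat_poly ?f A' \<in> carrier_mat n n" "mat_poly ?g A' \<in> carrier_mat n n"
    using mat_poly_carrier[OF A] mat_poly_carrier[OF w(5)] by auto
  have T: "?T \<in> carrier_mat n n" using w by simp
  have "R * A' = A * R"
    using w by (simp add: square_mat_simps[where n = n])
  then have f: "R * mat_poly ?f A' = mat_poly ?f A * R"
    by (rule mat_poly_intertwine[OF w(5) A w(6)])
  have "R' * A = R' * (R * (A' * R'))"
    using w(3) assoc_mult_mat[OF w(6,5,7)] by simp
  also have "\<dots> = (R' * R) * (A' * R')"
    by (rule assoc_mult_mat[OF w(7,6) mult_carrier_mat[OF w(5,7)], symmetric])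
  finally have "R' * A = A' * R'"
    unfolding w(2) using w(5,7) by simp
  then have g: "R' * mat_poly ?g A = mat_poly ?g A' * R'"
    by (rule mat_poly_intertwine[OF A w(5) w(7)])
  have g': "transpose_mat (mat_poly ?g A) * ?T = ?T * transpose_mat (mat_poly ?g A')"
    using arg_cong[OF g, of transpose_mat] transpose_mult[OF w(7) c(2)] transpose_mult[OF c(4) w(7)] by simp
  have "four_block_mat R ?Z ?Z ?T \<in> Sp n"
  proof (rule Sp_blockI)
    show "transpose_mat R * ?T - transpose_mat ?Z * ?Z = 1\<^sub>m n"
      using transpose_mult[OF w(7) w(6)] w by (auto intro!: eq_matI)
  qed (use w in auto)
  moreover have "hyp_mat p A * four_block_mat R ?Z ?Z ?T = four_block_mat R ?Z ?Z ?T * hyp_mat p A'"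
    unfolding hyp_mat_def carrier_matD(1)[OF A] carrier_matD(1)[OF w(5)]
    using A w(5) c w(6) T f g'
    by (subst (1 2) mult_four_block_mat[of _ n n _ n _ n _ _ n _ n]) auto
  ultimately show ?thesis
    using symplectically_similarI hyp_mat_carrier A w(5) by blast
qed

text \<open>
  With \<open>b = p(A)\<close> the relation \<open>BC = A\<^sup>2 - 1 = b\<^sup>2\<close> makes \<open>T = C b\<^bsup>-1\<^esup>\<close> a symmetric matrix with inverse
  \<open>S = b\<^bsup>-1\<^esup> B\<close>. The vectors \<open>(v, T v)\<close> are mapped by the Wonenburger matrix to \<open>(w, T w)\<close> with
  \<open>w = (A + b) v\<close>, and the vectors \<open>(v, - T v)\<close> to \<open>(w, - T w)\<close> with \<open>w = (A - b) v\<close>. The factor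
  \<open>1/2\<close> in the change of basis normalises the pairing of these two subspaces. The polynomial \<open>q\<close> only
  serves to invert \<open>b\<close>.
\<close>

lemma wonenburger_similar_hyp_mat:
  assumes W: "wonenburger_blocks n A B C"
    and p: "mat_poly (p * p - ([:0, 1:] * [:0, 1:] - 1)) A = 0\<^sub>m n n"
    and q: "mat_poly (p * q - 1) A = 0\<^sub>m n n"
  shows "symplectically_similar n (four_block_mat A B C (transpose_mat A)) (hyp_mat p A)"
proof -
  note c = wonenburger_blocksD(1-3)[OF W] and sym = wonenburger_blocksD(4,5)[OF W]
    and AB = wonenburger_blocksD(6)[OF W] and AC = wonenburger_blocksD(7)[OF W]
    and det = wonenburger_blocksD(8)[OF W]
  note A = c(1) and B = c(2) and C = c(3)
  define b where "b = mat_poly p A"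
  define e where "e = mat_poly q A"
  have b: "b \<in> carrier_mat n n" and e: "e \<in> carrier_mat n n"
    unfolding b_def e_def by (rule mat_poly_carrier[OF A])+
  let ?A = "transpose_mat A" and ?b = "transpose_mat b" and ?e = "transpose_mat e"
  have t: "?A \<in> carrier_mat n n" "?b \<in> carrier_mat n n" "?e \<in> carrier_mat n n"
    using A b e by auto
  note ring = square_mat_simps[where n = n]
  have zero_diff: "X = Y" if "X - Y = 0\<^sub>m n n" "X \<in> carrier_mat n n" "Y \<in> carrier_mat n n" for X Y :: "real mat"
  proof (rule eq_matI)
    fix i j assume "i < dim_row Y" "j < dim_col Y"
    then have ij: "i < dim_row Y" "j < dim_col Y" "i < n" "j < n" using that(3) by auto
    have "(X - Y) $$ (i, j) = 0" unfolding that(1) using ij by simp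
    then show "X $$ (i, j) = Y $$ (i, j)" using ij by simp
  qed (use that in auto)
  have "b * b = A * A - 1\<^sub>m n"
  proof (rule zero_diff)
    show "b * b - (A * A - 1\<^sub>m n) = 0\<^sub>m n n"
      using p unfolding mat_poly_diff[OF A] mat_poly_mult[OF A] mat_poly_X[OF A] mat_poly_1[OF A] b_def .
  qed (use A b in \<open>auto simp: minus_carrier_mat\<close>)
  also have "\<dots> = B * C"
    using det A B C by (intro eq_matI) (auto simp: det[symmetric])
  finally have bb: "B * C = b * b" ..
  have be: "b * e = 1\<^sub>m n"
  proof (rule zero_diff)
    show "b * e - 1\<^sub>m n = 0\<^sub>m n n"
      using q unfolding mat_poly_diff[OF A] mat_poly_mult[OF A] mat_poly_1[OF A] b_def e_def .
  qed (use b e in auto)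
  have eb: "e * b = 1\<^sub>m n"
    using be mat_poly_commute[OF A, of p q] by (simp add: b_def e_def)
  have eA: "A * e = e * A"
    unfolding e_def by (rule mat_poly_intertwine[OF A A A refl])
  have eB: "B * ?e = e * B"
    unfolding e_def mat_poly_transpose[OF A, symmetric]
    by (rule mat_poly_intertwine[OF t(1) A B AB[symmetric]])
  have bB: "B * ?b = b * B"
    unfolding b_def mat_poly_transpose[OF A, symmetric]
    by (rule mat_poly_intertwine[OF t(1) A B AB[symmetric]])
  have eC: "C * e = ?e * C"
    unfolding e_def mat_poly_transpose[OF A, symmetric]
    by (rule mat_poly_intertwine[OF A t(1) C AC[symmetric]])
  have cb: "C * B = ?b * ?b"
    using arg_cong[OF bb, of transpose_mat] transpose_mult[OF B C] transpose_mult[OF b b] sym by simp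
  have ebt: "?e * ?b = 1\<^sub>m n"
    using arg_cong[OF be, of transpose_mat] transpose_mult[OF b e] by simp
  \<comment> \<open>\<open>S\<close> and \<open>T\<close> are inverse to each other: the graphs of \<open>T\<close> and \<open>- T\<close> are the two invariant
    Lagrangian subspaces.\<close>
  define S where "S = e * B"
  define T where "T = C * e"
  have ST: "S \<in> carrier_mat n n" "T \<in> carrier_mat n n" using B C e by (auto simp: S_def T_def)
  have cancel: "e * (b * X) = X" "b * (e * X) = X" "?e * (?b * X) = X" if "X \<in> carrier_mat n n" for X
    using that b e t assoc_mult_mat[of e n n b n X n] assoc_mult_mat[of b n n e n X n]
      assoc_mult_mat[of ?e n n ?b n X n] by (simp_all add: be eb ebt)
  have ST1: "S * ?b = B" using B b e t cancel by (simp add: S_def ring bB)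
  have ST2: "T * b = C" using C e b by (simp add: T_def ring eb)
  have ST3: "B * T = b"
  proof -
    have "B * T = (B * C) * e" using B C e by (simp add: T_def ring)
    also have "\<dots> = b" unfolding bb using b e by (simp add: ring be)
    finally show ?thesis .
  qed
  have ST4: "A * S = S * ?A"
  proof -
    have "A * S = (A * e) * B" using A B e by (simp add: S_def ring)
    also have "\<dots> = e * (A * B)" unfolding eA using A B e by (simp add: ring)
    also have "\<dots> = S * ?A" unfolding AB using t B e by (simp add: S_def ring)
    finally show ?thesis .
  qed
  have ST5: "?A * T = T * A"
  proof -
    have "?A * T = (?A * C) * e" using t C e by (simp add: T_def ring)
    also have "\<dots> = C * (A * e)" unfolding AC using A C e by (simp add: ring)
    also have "\<dots> = T * A" unfolding eA using A C e by (simp add: T_def ring)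
    finally show ?thesis .
  qed
  have ST6: "C * S = ?b"
  proof -
    have "C * S = (C * e) * B" using C B e by (simp add: S_def ring)
    also have "\<dots> = ?e * (C * B)" unfolding eC using t C B by (simp add: ring)
    also have "\<dots> = ?b" unfolding cb by (rule cancel(3)[OF t(2)])
    finally show ?thesis .
  qed
  have S_sym: "transpose_mat S = S"
    using transpose_mult[OF e B] sym eB by (simp add: S_def)
  have T_sym: "transpose_mat T = T"
    using transpose_mult[OF C e] sym eC by (simp add: T_def)
  have TS: "T * S = 1\<^sub>m n"
  proof -
    have "T * S = ?e * (C * S)"
      unfolding T_def eC using t C ST by (simp add: ring)
    then show ?thesis unfolding ST6 ebt .
  qed
  define P where "P = four_block_mat (1\<^sub>m n) (- ((1/2) \<cdot>\<^sub>m S)) T ((1/2) \<cdot>\<^sub>m 1\<^sub>m n)"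
  have cP: "1\<^sub>m n \<in> carrier_mat n n" "- ((1/2) \<cdot>\<^sub>m S) \<in> carrier_mat n n" "T \<in> carrier_mat n n"
    "(1/2) \<cdot>\<^sub>m 1\<^sub>m n \<in> carrier_mat n n" using ST by auto
  have half_t: "transpose_mat (r \<cdot>\<^sub>m X) = r \<cdot>\<^sub>m transpose_mat X" for r :: real and X :: "real mat"
    by (rule eq_matI) auto
  have half_u: "r \<cdot>\<^sub>m (- X) = - (r \<cdot>\<^sub>m X)" for r :: real and X :: "real mat"
    by (rule eq_matI) auto
  have "P \<in> Sp n"
    unfolding P_def
  proof (rule Sp_blockI[OF cP])
    show "transpose_mat (1\<^sub>m n) * T = transpose_mat T * 1\<^sub>m n"
      using ST T_sym by simp
    show "transpose_mat (- ((1/2) \<cdot>\<^sub>m S)) * ((1/2) \<cdot>\<^sub>m 1\<^sub>m n) = transpose_mat ((1/2) \<cdot>\<^sub>m 1\<^sub>m n) * - ((1/2) \<cdot>\<^sub>m S)"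
      using ST S_sym by (simp add: transpose_uminus half_t half_u ring)
    show "transpose_mat (1\<^sub>m n) * ((1/2) \<cdot>\<^sub>m 1\<^sub>m n) - transpose_mat T * - ((1/2) \<cdot>\<^sub>m S) = 1\<^sub>m n"
      using ST T_sym TS by (auto simp: ring intro!: eq_matI)
  qed
  moreover have "four_block_mat A B C ?A * P = P * hyp_mat p A"
  proof -
    have h: "hyp_mat p A = four_block_mat (A + b) (0\<^sub>m n n) (0\<^sub>m n n) (?A - ?b)"
      using A b transpose_minus[OF A b]
      by (simp add: hyp_mat_def mat_poly_add[OF A] mat_poly_diff[OF A] mat_poly_X[OF A] b_def)
    have z: "0\<^sub>m n n \<in> carrier_mat n n" "A + b \<in> carrier_mat n n" "?A - ?b \<in> carrier_mat n n"
      using A b by auto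
    have "four_block_mat A B C ?A * P = four_block_mat (A + b) (- ((1/2) \<cdot>\<^sub>m (A * S)) + (1/2) \<cdot>\<^sub>m B)
        (C + T * A) (- ((1/2) \<cdot>\<^sub>m ?b) + (1/2) \<cdot>\<^sub>m ?A)"
      unfolding P_def mult_four_block_mat[OF A B C t(1) cP]
      using A B C t ST by (simp add: ring ST3 ST5 ST6)
    also have "\<dots> = four_block_mat (A + b) (- ((1/2) \<cdot>\<^sub>m (S * ?A - S * ?b)))
        (T * A + T * b) ((1/2) \<cdot>\<^sub>m (?A - ?b))"
      unfolding ST1 ST2 ST4[symmetric] using A B C t ST
      by (intro cong_four_block_mat) (auto intro!: eq_matI simp: comm_add_mat[of _ n n] diff_divide_distrib)
    also have "\<dots> = P * hyp_mat p A"
      unfolding P_def h mult_four_block_mat[OF cP z(2,1,1,3)]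
      using A b t ST
      by (intro cong_four_block_mat) (auto simp: ring diff_divide_distrib intro!: eq_matI)
    finally show ?thesis .
  qed
  moreover have "four_block_mat A B C ?A \<in> carrier_mat (2 * n) (2 * n)"
    unfolding mult_2 by (rule four_block_carrier_mat[OF A t(1)])
  ultimately show ?thesis using symplectically_similarI hyp_mat_carrier[OF A] by blast
qed

section \<open>Square roots of the normal form\<close>

lemma hyp_mat_blocks_inverse:
  assumes A: "A \<in> carrier_mat n n"
    and p: "mat_poly (p * p - ([:0, 1:] * [:0, 1:] - 1)) A = 0\<^sub>m n n"
  shows "mat_poly ([:0, 1:] + p) A * mat_poly ([:0, 1:] - p) A = 1\<^sub>m n"
    "mat_poly ([:0, 1:] - p) A * mat_poly ([:0, 1:] + p) A = 1\<^sub>m n"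
proof -
  have "([:0, 1:] + p) * ([:0, 1:] - p) = 1 - (p * p - ([:0, 1:] * [:0, 1:] - 1))"
    by (simp add: algebra_simps)
  then have "mat_poly ([:0, 1:] + p) A * mat_poly ([:0, 1:] - p) A =
      mat_poly (1 - (p * p - ([:0, 1:] * [:0, 1:] - 1))) A"
    by (simp only: mat_poly_mult[OF A, symmetric])
  also have "\<dots> = 1\<^sub>m n - 0\<^sub>m n n"
    unfolding mat_poly_diff[OF A, of 1] p mat_poly_1[OF A] ..
  also have "\<dots> = 1\<^sub>m n" by (rule eq_matI) auto
  finally show "mat_poly ([:0, 1:] + p) A * mat_poly ([:0, 1:] - p) A = 1\<^sub>m n" .
  then show "mat_poly ([:0, 1:] - p) A * mat_poly ([:0, 1:] + p) A = 1\<^sub>m n"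
    using mat_poly_commute[OF A] by metis
qed

text \<open>
  A root \<open>X\<close> commutes with the matrix and with its inverse, hence with their sum, which is
  \<open>2 diag(A, A\<^sup>T)\<close>, and with their difference, which is \<open>2 diag(p(A), - p(A)\<^sup>T)\<close>. So \<open>X\<close> preserves both
  Lagrangian subspaces, and its first block is the matrix \<open>Y\<close>.
\<close>

lemma sqrt_hyp_mat_commutes:
  assumes A: "A \<in> carrier_mat n n" and X: "X \<in> carrier_mat (2 * n) (2 * n)" and XX: "X * X = hyp_mat p A"
    and p: "mat_poly (p * p - ([:0, 1:] * [:0, 1:] - 1)) A = 0\<^sub>m n n"
    and q: "mat_poly (p * q - 1) A = 0\<^sub>m n n"
  shows "\<exists>Y. Y \<in> carrier_mat n n \<and> Y * A = A * Y \<and> Y * Y = mat_poly ([:0, 1:] + p) A"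
proof -
  let ?f = "[:0, 1:] + p" and ?g = "[:0, 1:] - p"
  define F where "F = mat_poly ?f A"
  define G where "G = mat_poly ?g A"
  define b where "b = mat_poly p A"
  let ?F = "transpose_mat F" and ?G = "transpose_mat G" and ?A = "transpose_mat A" and ?b = "transpose_mat b"
  have c: "F \<in> carrier_mat n n" "G \<in> carrier_mat n n" "b \<in> carrier_mat n n"
    unfolding F_def G_def b_def by (rule mat_poly_carrier[OF A])+
  have t: "?F \<in> carrier_mat n n" "?G \<in> carrier_mat n n" "?A \<in> carrier_mat n n" "?b \<in> carrier_mat n n"
    using A c by auto
  let ?Z = "0\<^sub>m n n :: real mat"
  have Z: "?Z \<in> carrier_mat n n" by simp
  note ring = square_mat_simps[where n = n]
  have FG: "F = A + b" "G = A - b"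
    by (simp_all add: F_def G_def b_def mat_poly_add[OF A] mat_poly_diff[OF A] mat_poly_X[OF A])
  have Ft: "?F = ?A + ?b" "?G = ?A - ?b"
    unfolding FG using transpose_add[OF A c(3)] transpose_minus[OF A c(3)] by auto
  define H where "H = hyp_mat p A"
  define K where "K = four_block_mat G ?Z ?Z ?F"
  have H: "H = four_block_mat F ?Z ?Z ?G"
    using A by (simp add: H_def hyp_mat_def F_def G_def)
  have cH: "H \<in> carrier_mat (2 * n) (2 * n)" "K \<in> carrier_mat (2 * n) (2 * n)"
    unfolding H K_def mult_2 by (intro four_block_carrier_mat c t)+
  have FG1: "F * G = 1\<^sub>m n" "G * F = 1\<^sub>m n"
    unfolding F_def G_def by (rule hyp_mat_blocks_inverse[OF A p])+
  have FGt: "?G * ?F = 1\<^sub>m n" "?F * ?G = 1\<^sub>m n"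
    unfolding transpose_mult[OF c(1,2), symmetric] transpose_mult[OF c(2,1), symmetric] FG1
    by simp_all
  have HK: "H * K = 1\<^sub>m (2 * n)" "K * H = 1\<^sub>m (2 * n)"
    unfolding H K_def mult_four_block_mat[OF c(1) Z Z t(2) c(2) Z Z t(1)]
      mult_four_block_mat[OF c(2) Z Z t(1) c(1) Z Z t(2)]
    using c t by (simp_all add: FG1 FGt mult_2)
  note ring2 = square_mat_simps[where n = "2 * n"]
  have XH: "X * H = H * X"
    unfolding H_def XX[symmetric] using X by (simp add: ring2)
  have "K * (X * H) * K = K * (H * X) * K" by (simp add: XH)
  moreover have "K * (X * H) * K = K * X * (H * K)" using X cH by (simp add: ring2)
  moreover have "K * (H * X) * K = (K * H) * (X * K)" using X cH by (simp add: ring2)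
  ultimately have XK: "X * K = K * X"
    unfolding HK using X cH by simp
  obtain Y U V W where sp: "split_block X n n = (Y, U, V, W)" by (cases "split_block X n n")
  note s = split_block[OF sp, of n n]
  have s: "Y \<in> carrier_mat n n" "U \<in> carrier_mat n n" "V \<in> carrier_mat n n" "W \<in> carrier_mat n n"
    "X = four_block_mat Y U V W"
    using s X by (auto simp: mult_2)
  have block_eq: "A1 = A2 \<and> B1 = B2"
    if "four_block_mat A1 B1 C1 D1 = four_block_mat A2 B2 C2 D2"
      and "A1 \<in> carrier_mat n n" "B1 \<in> carrier_mat n n" "D1 \<in> carrier_mat n n" "C1 \<in> carrier_mat n n"
      "A2 \<in> carrier_mat n n" "B2 \<in> carrier_mat n n" "D2 \<in> carrier_mat n n" "C2 \<in> carrier_mat n n"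
    for A1 A2 B1 B2 C1 C2 D1 D2 :: "real mat"
  proof
    have e: "four_block_mat A1 B1 C1 D1 $$ (i, j) = four_block_mat A2 B2 C2 D2 $$ (i, j)" for i j
      using that(1) by simp
    show "A1 = A2"
    proof (rule eq_matI)
      fix i j assume "i < dim_row A2" "j < dim_col A2"
      then show "A1 $$ (i, j) = A2 $$ (i, j)" using e[of i j] that(2-) by simp
    qed (use that in auto)
    show "B1 = B2"
    proof (rule eq_matI)
      fix i j assume "i < dim_row B2" "j < dim_col B2"
      then show "B1 $$ (i, j) = B2 $$ (i, j)" using e[of i "j + n"] that(2-) by simp
    qed (use that in auto)
  qed
  have XHb: "X * H = four_block_mat (Y * F) (U * ?G) (V * F) (W * ?G)"
    "H * X = four_block_mat (F * Y) (F * U) (?G * V) (?G * W)"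
    unfolding H s(5) mult_four_block_mat[OF s(1-4) c(1) Z Z t(2)] mult_four_block_mat[OF c(1) Z Z t(2) s(1-4)]
    using s c t by simp_all
  have XKb: "X * K = four_block_mat (Y * G) (U * ?F) (V * G) (W * ?F)"
    "K * X = four_block_mat (G * Y) (G * U) (?F * V) (?F * W)"
    unfolding K_def s(5) mult_four_block_mat[OF s(1-4) c(2) Z Z t(1)] mult_four_block_mat[OF c(2) Z Z t(1) s(1-4)]
    using s c t by simp_all
  have YF: "Y * F = F * Y" "U * ?G = F * U"
    using block_eq[OF XH[unfolded XHb]] s c t by auto
  have YG: "Y * G = G * Y" "U * ?F = G * U"
    using block_eq[OF XK[unfolded XKb]] s c t by auto
  have ent: "i < n \<Longrightarrow> j < n \<Longrightarrow> (P + Q) $$ (i, j) = P $$ (i, j) + Q $$ (i, j) \<and>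
      (P - Q) $$ (i, j) = P $$ (i, j) - Q $$ (i, j)"
    if "P \<in> carrier_mat n n" "Q \<in> carrier_mat n n" for P Q :: "real mat" and i j
    using that by simp
  have sum_diff: "P = P' \<and> Q = Q'"
    if "P + Q = P' + Q'" "P - Q = P' - Q'" "P \<in> carrier_mat n n" "Q \<in> carrier_mat n n"
      "P' \<in> carrier_mat n n" "Q' \<in> carrier_mat n n" for P Q P' Q' :: "real mat"
  proof -
    have "P $$ (i, j) = P' $$ (i, j) \<and> Q $$ (i, j) = Q' $$ (i, j)" if ij: "i < n" "j < n" for i j
      using ent[OF \<open>P \<in> _\<close> \<open>Q \<in> _\<close> ij] ent[OF \<open>P' \<in> _\<close> \<open>Q' \<in> _\<close> ij] \<open>P + Q = _\<close> \<open>P - Q = _\<close> by simp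
    then show ?thesis using that(3-) by (auto intro!: eq_matI)
  qed
  have YA: "Y * A = A * Y"
    using sum_diff[of "Y * A" "Y * b" "A * Y" "b * Y"] YF(1) YG(1) s A c
    by (simp add: FG ring)
  \<comment> \<open>The upper right block intertwines \<open>A\<close> with its transpose, hence also \<open>b\<close>; but it
    anti-intertwines \<open>b\<close>, so it vanishes because \<open>b\<close> is invertible.\<close>
  have Ub: "U * ?A = A * U \<and> U * ?b = - (b * U)"
  proof (rule sum_diff)
    show "U * ?A + U * ?b = A * U + - (b * U)"
      using YG(2)[unfolded Ft(1) FG(2)] s A c t by (simp add: ring add_uminus_minus_mat[of _ n n])
    show "U * ?A - U * ?b = A * U - - (b * U)"
      using YF(2)[unfolded Ft(2) FG(1)] s A c t by (simp add: ring minus_add_uminus_mat[of _ n n])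
  qed (use s A c t in auto)
  have "U * ?b = b * U"
    unfolding b_def mat_poly_transpose[OF A, symmetric]
    by (rule mat_poly_intertwine[OF t(3) A s(2)]) (use Ub in simp)
  then have bU: "b * U = 0\<^sub>m n n"
  proof -
    assume "U * ?b = b * U"
    then have "b * U = - (b * U)" using Ub by simp
    then have "(b * U) $$ (i, j) = - (b * U) $$ (i, j)" if "i < n" "j < n" for i j
      using that c s by (metis carrier_matD index_uminus_mat(1) mult_carrier_mat)
    then show ?thesis using c s by (intro eq_matI) auto
  qed
  define e where "e = mat_poly q A"
  have e: "e \<in> carrier_mat n n" unfolding e_def by (rule mat_poly_carrier[OF A])
  have "e * b = 1\<^sub>m n"
  proof -
    have "e * b = mat_poly (1 + (p * q - 1)) A"
      by (simp add: e_def b_def mat_poly_mult[OF A, symmetric] mult.commute)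
    also have "\<dots> = 1\<^sub>m n" unfolding mat_poly_add[OF A] q mat_poly_1[OF A] by simp
    finally show ?thesis .
  qed
  then have "U = (e * b) * U" using s by simp
  also have "\<dots> = e * (b * U)" by (rule assoc_mult_mat[OF e c(3) s(2)])
  also have "\<dots> = 0\<^sub>m n n" unfolding bU using e by simp
  finally have U: "U = 0\<^sub>m n n" .
  have "Y * Y = F"
  proof -
    have "four_block_mat (Y * Y + U * V) (Y * U + U * W) (V * Y + W * V) (V * U + W * W) = four_block_mat F ?Z ?Z ?G"
      unfolding mult_four_block_mat[OF s(1-4) s(1-4), symmetric] s(5)[symmetric] XX H[symmetric] H_def ..
    then have "Y * Y + U * V = F"
      by (rule block_eq[THEN conjunct1]) (use s c t in auto)
    then show ?thesis using s unfolding U by simp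
  qed
  then show ?thesis using YA s(1) by (auto simp: F_def)
qed

text \<open>
  Conversely a root \<open>Y\<close> of the first block extends to \<open>diag(Y, Y\<^bsup>-T\<^esup>)\<close>, where \<open>Y\<^bsup>-1\<^esup> = (A - p(A)) Y\<close>.
\<close>

lemma sqrt_hyp_matI:
  assumes A: "A \<in> carrier_mat n n"
    and p: "mat_poly (p * p - ([:0, 1:] * [:0, 1:] - 1)) A = 0\<^sub>m n n"
    and Y: "Y \<in> carrier_mat n n" and YY: "Y * Y = mat_poly ([:0, 1:] + p) A"
  shows "\<exists>X. symplectic_sqrt n (hyp_mat p A) X"
proof -
  define F where "F = mat_poly ([:0, 1:] + p) A"
  define G where "G = mat_poly ([:0, 1:] - p) A"
  have c: "F \<in> carrier_mat n n" "G \<in> carrier_mat n n"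
    unfolding F_def G_def by (rule mat_poly_carrier[OF A])+
  note ring = square_mat_simps[where n = n]
  let ?Z = "0\<^sub>m n n :: real mat"
  have FG: "F * G = 1\<^sub>m n" "G * F = 1\<^sub>m n"
    unfolding F_def G_def by (rule hyp_mat_blocks_inverse[OF A p])+
  have F: "F = Y * Y" by (simp add: F_def YY)
  have YF: "Y * F = F * Y" unfolding F using Y by (simp add: ring)
  have "G * (Y * F) * G = G * (F * Y) * G" by (simp add: YF)
  moreover have "G * (Y * F) * G = G * Y * (F * G)" "G * (F * Y) * G = (G * F) * (Y * G)"
    using Y c by (simp_all add: ring)
  ultimately have GY: "G * Y = Y * G" unfolding FG using Y c by simp
  define W where "W = transpose_mat (G * Y)"
  have W: "W \<in> carrier_mat n n" using Y c by (auto simp: W_def)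
  have "(G * Y) * (G * Y) = (G * Y) * (Y * G)" by (simp add: GY)
  also have "\<dots> = G * (F * G)" unfolding F using Y c by (simp add: ring)
  also have "\<dots> = G" unfolding FG using c by simp
  finally have "W * W = transpose_mat G"
    unfolding W_def transpose_mult[OF mult_carrier_mat[OF c(2) Y] mult_carrier_mat[OF c(2) Y], symmetric] by simp
  then have "four_block_mat Y ?Z ?Z W * four_block_mat Y ?Z ?Z W = hyp_mat p A"
    using A Y W c by (subst mult_four_block_mat[of _ n n _ n _ n _ _ n _ n])
      (simp_all add: hyp_mat_def YY F_def[symmetric] G_def[symmetric])
  moreover have "four_block_mat Y ?Z ?Z W \<in> Sp n"
  proof (rule Sp_blockI)
    have "(G * Y) * Y = 1\<^sub>m n" unfolding FG(2)[symmetric] F using Y c by (simp add: ring)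
    then have "transpose_mat Y * W = 1\<^sub>m n"
      unfolding W_def transpose_mult[OF mult_carrier_mat[OF c(2) Y] Y, symmetric] by simp
    then show "transpose_mat Y * W - transpose_mat ?Z * ?Z = 1\<^sub>m n"
      by (auto intro!: eq_matI)
  qed (use Y W in auto)
  ultimately show ?thesis
    using pow_mat_2[OF Sp_carrier] unfolding symplectic_sqrt_def by metis
qed

section \<open>The spectrum of a Wonenburger matrix\<close>

text \<open>
  With \<open>D = A\<^sup>T\<close> the matrix \<open>M\<close> in question satisfies \<open>M + M\<^bsup>-1\<^esup> = 2 diag(A, D)\<close>, so that
  \<open>(M - r)(M - s) = M\<^sup>2 - 2\<nu>M + 1 = M (M + M\<^bsup>-1\<^esup> - 2\<nu>)\<close>. Taking determinants relates the eigenvalues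
  \<open>\<nu>\<close> of \<open>A\<close> to the eigenvalues \<open>r\<close> and \<open>s\<close> of \<open>M\<close>.
\<close>

lemma shifted_product_block_mat:
  fixes A B C D :: "'a :: field mat"
  assumes c: "A \<in> carrier_mat n n" "B \<in> carrier_mat n n" "C \<in> carrier_mat n n" "D \<in> carrier_mat n n"
    and AB: "A * B = B * D" and DC: "D * C = C * A"
    and AA: "A * A - B * C = 1\<^sub>m n" and DD: "D * D - C * B = 1\<^sub>m n"
    and r: "r * s = 1" "r + s = 2 * \<nu>"
  shows "char_matrix (four_block_mat A B C D) r * char_matrix (four_block_mat A B C D) s =
    four_block_mat A B C D *
      four_block_mat (2 \<cdot>\<^sub>m char_matrix A \<nu>) (0\<^sub>m n n) (0\<^sub>m n n) (2 \<cdot>\<^sub>m char_matrix D \<nu>)"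
proof -
  have cm: "char_matrix (four_block_mat A B C D) x = four_block_mat (char_matrix A x) B C (char_matrix D x)" for x
    using c by (intro eq_matI) (auto simp: char_matrix_def)
  have cc: "char_matrix A x \<in> carrier_mat n n" "char_matrix D x \<in> carrier_mat n n" for x
    using c by auto
  have p: "(X * Y) $$ (i, j) = (\<Sum>k<n. X $$ (i, k) * Y $$ (k, j))"
    if "X \<in> carrier_mat n n" "Y \<in> carrier_mat n n" "i < n" "j < n" for X Y :: "'a mat" and i j
    using that by (simp add: scalar_prod_def lessThan_atLeast0)
  have e: "(U - V) $$ (i, j) = U $$ (i, j) - V $$ (i, j)"
    if "U \<in> carrier_mat n n" "V \<in> carrier_mat n n" "i < n" "j < n" for U V :: "'a mat" and i j
    using that by simp
  have left: "char_matrix X x * Y = X * Y - x \<cdot>\<^sub>m Y" and right: "Y * char_matrix X x = Y * X - x \<cdot>\<^sub>m Y"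
    if "X \<in> carrier_mat n n" "Y \<in> carrier_mat n n" for X Y :: "'a mat" and x
    using that unfolding char_matrix_def carrier_matD(1)[OF that(1)]
    by (auto simp: add_mult_distrib_mat[of _ n n _ _ n] mult_add_distrib_mat[of _ n n _ n]
        mult_smult_assoc_mat[of _ n n _ n] mult_smult_distrib[of _ n n _ n] intro!: eq_matI)
  have r2: "r = 2 * \<nu> - s" using r(2) by (simp add: eq_diff_eq)
  have sq: "char_matrix X r * char_matrix X s + W = X * (2 \<cdot>\<^sub>m char_matrix X \<nu>)"
    if X: "X \<in> carrier_mat n n" and W: "W \<in> carrier_mat n n" and XX: "X * X - W = 1\<^sub>m n" for X W :: "'a mat"
  proof -
    have cX: "char_matrix X x \<in> carrier_mat n n" for x using X by simp
    have 1: "char_matrix X r * char_matrix X s = (X * X - s \<cdot>\<^sub>m X) - r \<cdot>\<^sub>m char_matrix X s"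
      unfolding left[OF X cX] right[OF X X] ..
    have 2: "X * (2 \<cdot>\<^sub>m char_matrix X \<nu>) = 2 \<cdot>\<^sub>m (X * X - \<nu> \<cdot>\<^sub>m X)"
      unfolding mult_smult_distrib[OF X cX] right[OF X X] ..
    show ?thesis
    proof (rule eq_matI)
      fix i j assume "i < dim_row (X * (2 \<cdot>\<^sub>m char_matrix X \<nu>))" "j < dim_col (X * (2 \<cdot>\<^sub>m char_matrix X \<nu>))"
      then have ij: "i < n" "j < n" using X by (auto simp: char_matrix_def)
      define d where "d = (1\<^sub>m n :: 'a mat) $$ (i, j)"
      have w: "W $$ (i, j) = (X * X) $$ (i, j) - d"
        using arg_cong[OF XX, of "\<lambda>Z. Z $$ (i, j)"] e[OF mult_carrier_mat[OF X X] W ij] by (simp add: d_def algebra_simps)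
      have x: "char_matrix X s $$ (i, j) = X $$ (i, j) - s * d"
        using X ij by (simp add: char_matrix_def d_def)
      have "(char_matrix X r * char_matrix X s + W) $$ (i, j) =
          (X * X) $$ (i, j) - s * X $$ (i, j) - r * (X $$ (i, j) - s * d) + ((X * X) $$ (i, j) - d)"
        unfolding 1 using X W ij by (simp add: w x carrier_matD[OF cX] del: index_mult_mat(1))
      also have "\<dots> = 2 * ((X * X) $$ (i, j) - \<nu> * X $$ (i, j)) + (r * s - 1) * d"
        unfolding r2 by (simp add: algebra_simps)
      also have "\<dots> = (X * (2 \<cdot>\<^sub>m char_matrix X \<nu>)) $$ (i, j)"
        unfolding 2 using X ij by (simp add: r(1) del: index_mult_mat(1))
      finally show "(char_matrix X r * char_matrix X s + W) $$ (i, j) = (X * (2 \<cdot>\<^sub>m char_matrix X \<nu>)) $$ (i, j)" .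
    qed (use X W in \<open>auto simp: carrier_matD[OF cX]\<close>)
  qed
  have off: "char_matrix X r * Y + Y * char_matrix Z s = Y * (2 \<cdot>\<^sub>m char_matrix Z \<nu>)"
    if X: "X \<in> carrier_mat n n" and Y: "Y \<in> carrier_mat n n" and Z: "Z \<in> carrier_mat n n"
      and XY: "X * Y = Y * Z" for X Y Z :: "'a mat"
  proof -
    have cZ: "char_matrix Z x \<in> carrier_mat n n" for x using Z by simp
    have "Y * (2 \<cdot>\<^sub>m char_matrix Z \<nu>) = 2 \<cdot>\<^sub>m (Y * Z - \<nu> \<cdot>\<^sub>m Y)"
      unfolding mult_smult_distrib[OF Y cZ] right[OF Z Y] ..
    then show ?thesis
      unfolding left[OF X Y] right[OF Z Y] XY using Y Z
      by (intro eq_matI) (auto simp: r2 algebra_simps simp del: index_mult_mat(1))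
  qed
  have "four_block_mat (char_matrix A r) B C (char_matrix D r) * four_block_mat (char_matrix A s) B C (char_matrix D s) =
    four_block_mat (A * (2 \<cdot>\<^sub>m char_matrix A \<nu>)) (B * (2 \<cdot>\<^sub>m char_matrix D \<nu>))
      (C * (2 \<cdot>\<^sub>m char_matrix A \<nu>)) (D * (2 \<cdot>\<^sub>m char_matrix D \<nu>))"
    unfolding mult_four_block_mat[OF cc(1) c(2,3) cc(2) cc(1) c(2,3) cc(2)]
  proof (rule cong_four_block_mat)
    show "char_matrix A r * char_matrix A s + B * C = A * (2 \<cdot>\<^sub>m char_matrix A \<nu>)"
      using sq AA c by simp
    show "char_matrix A r * B + B * char_matrix D s = B * (2 \<cdot>\<^sub>m char_matrix D \<nu>)"
      by (rule off[OF c(1,2,4) AB])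
    have "C * char_matrix A s + char_matrix D r * C = C * (2 \<cdot>\<^sub>m char_matrix A \<nu>)"
      using off[OF c(4,3,1) DC] comm_add_mat[OF mult_carrier_mat[OF c(3) cc(1)[of s]] mult_carrier_mat[OF cc(2)[of r] c(3)]] by simp
    then show "C * char_matrix A s + char_matrix D r * C = C * (2 \<cdot>\<^sub>m char_matrix A \<nu>)" .
    have "char_matrix D r * char_matrix D s + C * B = D * (2 \<cdot>\<^sub>m char_matrix D \<nu>)"
      using sq DD c by simp
    then show "C * B + char_matrix D r * char_matrix D s = D * (2 \<cdot>\<^sub>m char_matrix D \<nu>)"
      using comm_add_mat[OF mult_carrier_mat[OF c(3,2)] mult_carrier_mat[OF cc(2)[of r] cc(2)[of s]]] by simp
  qed
  also have "\<dots> = four_block_mat A B C D *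
      four_block_mat (2 \<cdot>\<^sub>m char_matrix A \<nu>) (0\<^sub>m n n) (0\<^sub>m n n) (2 \<cdot>\<^sub>m char_matrix D \<nu>)"
    using c cc by (subst mult_four_block_mat[of _ n n _ n _ n _ _ n _ n]) auto
  finally show ?thesis unfolding cm .
qed

text \<open>
  An eigenvalue \<open>\<nu>\<close> of \<open>A\<close> is \<open>(r + r\<^bsup>-1\<^esup>) / 2\<close> for some eigenvalue \<open>r\<close> of the Wonenburger matrix,
  so both \<open>r = l\<close> and \<open>r = l\<^bsup>-1\<^esup>\<close> yield the same real number. Having it as its only complex eigenvalue, \<open>A\<close>
  has a Jordan form over the reals.
\<close>

lemma wonenburger_spectrum_imp_jordan:
  fixes l :: real
  assumes W: "wonenburger_blocks n A B C"
    and l: "l \<noteq> 0"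
    and spec: "spectrum (map_mat complex_of_real (four_block_mat A B C (transpose_mat A))) \<subseteq>
      {complex_of_real l, complex_of_real (inverse l)}"
  shows "\<exists>ks. 0 \<notin> set ks \<and> similar_mat A (jordan ((l + inverse l) / 2) ks)"
proof -
  note c = wonenburger_blocksD(1-3)[OF W] and sym = wonenburger_blocksD(4,5)[OF W]
    and AB = wonenburger_blocksD(6)[OF W] and AC = wonenburger_blocksD(7)[OF W]
    and AA = wonenburger_blocksD(8)[OF W]
  let ?\<mu> = "(l + inverse l) / 2" and ?h = "map_mat complex_of_real" and ?A = "transpose_mat A"
  have t: "?A \<in> carrier_mat n n" using c by simp
  have DD: "?A * ?A - C * B = 1\<^sub>m n"
    using arg_cong[OF AA, of transpose_mat] c t sym[symmetric]
    by (simp add: transpose_minus[of _ n n] transpose_mult[of _ n n _ n])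
  define M where "M = four_block_mat (?h A) (?h B) (?h C) (?h ?A)"
  have M_eq: "?h (four_block_mat A B C ?A) = M"
    unfolding M_def by (rule map_four_block_mat[OF c t])
  have hc: "?h A \<in> carrier_mat n n" "?h B \<in> carrier_mat n n" "?h C \<in> carrier_mat n n" "?h ?A \<in> carrier_mat n n"
    using c t by auto
  have M: "M \<in> carrier_mat (n + n) (n + n)" unfolding M_def by (rule four_block_carrier_mat[OF hc(1,4)])
  have h_minus: "?h (X - Y) = ?h X - ?h Y" if "X \<in> carrier_mat n n" "Y \<in> carrier_mat n n" for X Y
    using that by (auto intro!: eq_matI)
  have h1: "?h (1\<^sub>m n) = 1\<^sub>m n" by (rule of_real_hom.mat_hom_one)
  have hAB: "?h A * ?h B = ?h B * ?h ?A"
    using arg_cong[OF AB, of ?h] of_real_hom.mat_hom_mult c t by metis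
  have hAC: "?h ?A * ?h C = ?h C * ?h A"
    using arg_cong[OF AC, of ?h] of_real_hom.mat_hom_mult c t by metis
  have hAA: "?h A * ?h A - ?h B * ?h C = 1\<^sub>m n"
    unfolding of_real_hom.mat_hom_mult[OF c(1,1), symmetric] of_real_hom.mat_hom_mult[OF c(2,3), symmetric]
      h_minus[OF mult_carrier_mat[OF c(1,1)] mult_carrier_mat[OF c(2,3)], symmetric] AA by (rule h1)
  have hDD: "?h ?A * ?h ?A - ?h C * ?h B = 1\<^sub>m n"
    unfolding of_real_hom.mat_hom_mult[OF t t, symmetric] of_real_hom.mat_hom_mult[OF c(3,2), symmetric]
      h_minus[OF mult_carrier_mat[OF t t] mult_carrier_mat[OF c(3,2)], symmetric] DD by (rule h1)
  have root: "\<nu> = complex_of_real ?\<mu>" if \<nu>: "poly (char_poly (?h A)) \<nu> = 0" for \<nu>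
  proof -
    \<comment> \<open>\<open>r\<close> and \<open>s\<close> are the roots of \<open>z\<^sup>2 - 2\<nu>z + 1\<close>.\<close>
    define r where "r = \<nu> + csqrt (\<nu> ^ 2 - 1)"
    define s where "s = \<nu> - csqrt (\<nu> ^ 2 - 1)"
    have rs: "r * s = 1" "r + s = 2 * \<nu>"
      by (simp_all add: r_def s_def algebra_simps flip: power2_eq_square)
    have dA: "det (char_matrix (?h A) \<nu>) = 0"
      using \<nu> unfolding eigenvalue_root_char_poly[OF hc(1), symmetric] eigenvalue_det[OF hc(1)] .
    have cA: "char_matrix (?h A) \<nu> \<in> carrier_mat n n" "char_matrix (?h ?A) \<nu> \<in> carrier_mat n n"
      using hc by auto
    have "det (char_matrix M r) * det (char_matrix M s) = det (char_matrix M r * char_matrix M s)"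
      using M by (intro det_mult[symmetric, of _ "n + n"]) auto
    also have "\<dots> = det M * det (four_block_mat (2 \<cdot>\<^sub>m char_matrix (?h A) \<nu>) (0\<^sub>m n n) (0\<^sub>m n n) (2 \<cdot>\<^sub>m char_matrix (?h ?A) \<nu>))"
      unfolding M_def shifted_product_block_mat[OF hc hAB hAC hAA hDD rs]
      by (rule det_mult[OF M[unfolded M_def]], rule four_block_carrier_mat) (use cA in auto)
    also have "det (four_block_mat (2 \<cdot>\<^sub>m char_matrix (?h A) \<nu>) (0\<^sub>m n n) (0\<^sub>m n n) (2 \<cdot>\<^sub>m char_matrix (?h ?A) \<nu>)) =
        det (2 \<cdot>\<^sub>m char_matrix (?h A) \<nu>) * det (2 \<cdot>\<^sub>m char_matrix (?h ?A) \<nu>)"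
      by (rule det_four_block_mat_lower_left_zero) (use cA in auto)
    also have "det (2 \<cdot>\<^sub>m char_matrix (?h A) \<nu>) = 0" by (simp add: dA)
    finally have "det (char_matrix M r) = 0 \<or> det (char_matrix M s) = 0" by simp
    then have "r \<in> spectrum M \<or> s \<in> spectrum M"
      by (simp add: spectrum_def eigenvalue_det[OF M])
    then have "r \<in> {complex_of_real l, complex_of_real (inverse l)} \<or> s \<in> {complex_of_real l, complex_of_real (inverse l)}"
      using spec unfolding M_eq by blast
    moreover have "x + y = complex_of_real l + complex_of_real (inverse l)"
      if "x \<in> {complex_of_real l, complex_of_real (inverse l)}" "x * y = 1" for x y
    proof -
      have "y = inverse x" using that(2) by (simp add: inverse_unique)
      then show ?thesis using that(1) by (auto simp: of_real_inverse)
    qed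
    ultimately have "r + s = complex_of_real l + complex_of_real (inverse l)"
      using rs(1) by (metis add.commute mult.commute)
    then show ?thesis unfolding rs(2) by (simp add: field_simps)
  qed
  obtain as where as: "char_poly (?h A) = (\<Prod>a\<leftarrow>as. [:- a, 1:])" "length as = n"
    using char_poly_factorized[OF hc(1)] by blast
  have "set as \<subseteq> {complex_of_real ?\<mu>}"
    using root unfolding as(1) by (auto simp: poly_prod_list prod_list_zero_iff)
  then have "as = replicate n (complex_of_real ?\<mu>)"
    using as(2) by (metis replicate_eqI singletonD subsetD)
  then have "char_poly (?h A) = [:- complex_of_real ?\<mu>, 1:] ^ n"
    unfolding as(1) by (simp add: prod_list_replicate)
  also have "\<dots> = map_poly complex_of_real ([:- ?\<mu>, 1:] ^ n)"
  proof -
    interpret of_real_poly: map_poly_comm_ring_hom complex_of_real ..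
    show ?thesis by (simp add: of_real_poly.hom_power)
  qed
  finally have "map_poly complex_of_real (char_poly A) = map_poly complex_of_real ([:- ?\<mu>, 1:] ^ n)"
    unfolding of_real_hom.char_poly_hom[OF c(1)] .
  then have "coeff (char_poly A) i = coeff ([:- ?\<mu>, 1:] ^ n) i" for i
    by (metis coeff_map_poly of_real_0 of_real_eq_iff)
  then have cp: "char_poly A = [:- ?\<mu>, 1:] ^ n" by (rule poly_eqI)
  also have "\<dots> = (\<Prod>a\<leftarrow>replicate n ?\<mu>. [:- a, 1:])" by (simp add: prod_list_replicate)
  finally obtain n_as where nf: "jordan_nf A n_as" using jordan_nf_exists[OF c(1)] by blast
  have "a = ?\<mu>" if mem: "(k, a) \<in> set n_as" for k a
  proof -
    have k: "k \<noteq> 0" using nf mem unfolding jordan_nf_def by force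
    have "poly (\<Prod>(n, a)\<leftarrow>n_as. [:- a, 1:] ^ n) a = 0"
      using mem k by (force simp: poly_prod_list prod_list_zero_iff poly_power)
    then have "poly ([:- ?\<mu>, 1:] ^ n) a = 0" using jordan_nf_char_poly[OF nf] cp by simp
    then show ?thesis by (simp add: poly_power)
  qed
  note ev = this
  have "map (\<lambda>k. (k, ?\<mu>)) (map fst n_as) = n_as"
    unfolding map_map
  proof (rule map_idI)
    fix x assume "x \<in> set n_as"
    then have "snd x = ?\<mu>" using ev by (metis prod.collapse)
    then show "((\<lambda>k. (k, ?\<mu>)) \<circ> fst) x = x" by (metis o_apply prod.collapse)
  qed
  then have "jordan_matrix n_as = jordan ?\<mu> (map fst n_as)" unfolding jordan_def by metis
  then have "similar_mat A (jordan ?\<mu> (map fst n_as))" "0 \<notin> set (map fst n_as)"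
    using nf unfolding jordan_nf_def by auto
  then show ?thesis by blast
qed

lemma spectrum_of_real_similar:
  assumes "similar_mat M N" "M \<in> carrier_mat n n"
  shows "spectrum (map_mat complex_of_real M) = spectrum (map_mat complex_of_real N)"
proof -
  have N: "N \<in> carrier_mat n n" using similar_matD[OF assms(1)] assms(2) by auto
  have "char_poly (map_mat complex_of_real M) = char_poly (map_mat complex_of_real N)"
    unfolding of_real_hom.char_poly_hom[OF assms(2)] of_real_hom.char_poly_hom[OF N]
    by (simp add: char_poly_similar[OF assms(1)])
  then show ?thesis
    using assms(2) N by (simp add: spectrum_root_char_poly[of _ n])
qed

section \<open>Symplectic square roots of Wonenburger matrices\<close>

theorem theoremB:
  fixes l :: real and n :: nat and M :: "real mat"
  assumes "l < 0" and "l \<noteq> - 1"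
    and "wonenburger n M"
    and "spectrum (map_mat complex_of_real M) \<subseteq> {complex_of_real l, complex_of_real (inverse l)}"
    and "Polynomial.order l (char_poly M) = n"
    and "Polynomial.order (inverse l) (char_poly M) = n"
  shows "(\<exists>X. symplectic_sqrt n M X) \<longleftrightarrow>
    even n \<and> (\<exists>M\<^sub>1. wonenburger (n div 2) M\<^sub>1 \<and> symplectically_similar n M (diamond_power M\<^sub>1 2))"
proof -
  define \<mu> where "\<mu> = (l + inverse l) / 2"
  define s where "s = (l - inverse l) / 2"
  define x where "x = ([:0, 1:] :: real poly)"
  have "s \<noteq> 0"
  proof
    assume "s = 0"
    then have "l * l = 1" using assms(1) by (simp add: s_def field_simps)
    then have "l = 1 \<or> l = - 1" by (simp add: square_eq_1_iff)
    then show False using assms(1,2) by simp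
  qed
  have s_square: "poly (x * x - 1) \<mu> = s ^ 2" and s_add: "\<mu> + s = l"
    using assms(1) by (simp_all add: x_def s_def \<mu>_def field_simps power2_eq_square)
  obtain p where p\<mu>: "poly p \<mu> = s" and p_sq: "[:- \<mu>, 1:] ^ Suc n dvd p ^ 2 - (x * x - 1)"
    using poly_square_root_mod_power[OF s_square \<open>s \<noteq> 0\<close>] by blast
  have p_dvd: "[:- \<mu>, 1:] ^ n dvd p * p - (x * x - 1)"
    using p_sq unfolding power2_eq_square by (rule dvd_trans[OF le_imp_power_dvd[OF le_SucI[OF order_refl]]])
  obtain q where q_dvd: "[:- \<mu>, 1:] ^ n dvd p * q - 1"
    using poly_inverse_mod_power[of p \<mu> n] p\<mu> \<open>s \<noteq> 0\<close> by blast
  \<comment> \<open>The value of \<open>- (x + p)\<close> at \<open>\<mu>\<close> is \<open>- l\<close>, which is positive.\<close>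
  obtain k where "[:- \<mu>, 1:] ^ Suc n dvd k ^ 2 - - (x + p)"
    using poly_square_root_mod_power[of "- (x + p)" \<mu> "sqrt (- l)" n] s_add p\<mu> assms(1)
    by (auto simp: x_def)
  then have k_dvd: "[:- \<mu>, 1:] ^ n dvd k * k - - (x + p)"
    unfolding power2_eq_square by (rule dvd_trans[OF le_imp_power_dvd[OF le_SucI[OF order_refl]]])
  have vanish: "mat_poly f A = 0\<^sub>m n n"
    if "similar_mat A (jordan \<mu> ks)" "[:- \<mu>, 1:] ^ n dvd f" "sum_list ks = n" for A f ks
    using that by (intro mat_poly_eq_0_if_similar[of "jordan \<mu> ks" n \<mu>]) (auto simp: jordan_entry)
  have dim: "sum_list ks = n" if sim: "similar_mat A (jordan \<mu> ks)" and A: "A \<in> carrier_mat n n" for A ks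
  proof -
    obtain r where "A \<in> carrier_mat r r" "jordan \<mu> ks \<in> carrier_mat r r"
      using similar_matD[OF sim] by blast
    then show ?thesis using A jordan_carrier[of \<mu> ks] by (metis carrier_matD(1))
  qed
  have split: "symplectically_similar n (four_block_mat A B C (transpose_mat A)) (hyp_mat p A)"
    if W: "wonenburger_blocks n A B C" and sim: "similar_mat A (jordan \<mu> ks)" for A B C ks
  proof -
    note v = vanish[OF sim _ dim[OF sim wonenburger_blocksD(1)[OF W]]]
    show ?thesis
      by (rule wonenburger_similar_hyp_mat[OF W v[OF p_dvd[unfolded x_def]] v[OF q_dvd]])
  qed
  have jordan: "\<exists>ks. 0 \<notin> set ks \<and> similar_mat A (jordan \<mu> ks)"
    if "wonenburger_blocks n A B C"
      and "spectrum (map_mat complex_of_real (four_block_mat A B C (transpose_mat A))) \<subseteq>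
        {complex_of_real l, complex_of_real (inverse l)}" for A B C
    unfolding \<mu>_def using wonenburger_spectrum_imp_jordan[OF that(1) _ that(2)] assms(1) by simp
  show ?thesis
  proof
    assume "\<exists>X. symplectic_sqrt n M X"
    then obtain X where X: "symplectic_sqrt n M X" by blast
    obtain A B C where W: "wonenburger_blocks n A B C" and M: "M = four_block_mat A B C (transpose_mat A)"
      using assms(3) unfolding wonenburger_iff_blocks by blast
    note A = wonenburger_blocksD(1)[OF W]
    obtain ks where pos: "0 \<notin> set ks" and sim: "similar_mat A (jordan \<mu> ks)"
      using jordan[OF W] assms(4) unfolding M by blast
    have ks: "sum_list ks = n" by (rule dim[OF sim A])
    \<comment> \<open>Transport the root to the split form of a Jordan matrix similar to \<open>A\<close>, and read off its first block.\<close>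
    let ?J = "jordan \<mu> ks"
    have J: "?J \<in> carrier_mat n n" using jordan_carrier[of \<mu> ks] by (simp add: ks)
    note vJ = vanish[OF similar_mat_refl[OF J] _ ks]
    have MJ: "symplectically_similar n M (hyp_mat p ?J)"
      using symplectically_similar_trans[OF split[OF W sim] hyp_mat_similar[OF A sim]] by (simp add: M)
    then obtain X' where X': "symplectic_sqrt n (hyp_mat p ?J) X'"
      using symplectic_sqrt_transfer[OF _ X] by blast
    have cX': "X' \<in> carrier_mat (2 * n) (2 * n)" using X' Sp_carrier unfolding symplectic_sqrt_def by blast
    have "X' * X' = hyp_mat p ?J"
      using X' pow_mat_2[OF cX'] unfolding symplectic_sqrt_def by simp
    from sqrt_hyp_mat_commutes[OF J cX' this vJ[OF p_dvd[unfolded x_def]] vJ[OF q_dvd]]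
    obtain Y where Y: "Y \<in> carrier_mat n n" "Y * ?J = ?J * Y" "Y * Y = mat_poly (x + p) ?J"
      unfolding x_def by blast
    have "poly (x + p) \<mu> < 0" using s_add p\<mu> assms(1) by (simp add: x_def)
    then obtain ms where ms': "mset ks = mset (ms @ ms)"
      using jordan_blocks_doubled[OF pos _ Y(2,3)] Y(1) ks by blast
    have "sum_list ks = sum_list (ms @ ms)" using ms' by (metis sum_mset_sum_list)
    then have n: "n = sum_list ms + sum_list ms" by (simp add: ks)
    define m where "m = sum_list ms"
    define a where "a = jordan \<mu> ms"
    have a: "a \<in> carrier_mat m m" unfolding a_def m_def by (rule jordan_carrier)
    have aa: "jordan \<mu> (ms @ ms) = four_block_mat a (0\<^sub>m m m) (0\<^sub>m m m) a"
      unfolding a_def m_def by (rule jordan_append)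
    have "[:- \<mu>, 1:] ^ m dvd p * p - (x * x - 1)"
      using p_dvd n by (metis m_def le_add1 power_le_dvd)
    then have va: "mat_poly (p * p - (x * x - 1)) a = 0\<^sub>m m m"
      by (intro mat_poly_eq_0_if_similar[OF a _ _ similar_mat_refl[OF a]])
        (auto simp: a_def m_def jordan_entry)
    \<comment> \<open>The flip \<open>S\<close> turns \<open>a\<close> into the \<open>A\<close>-block of a Wonenburger matrix, whose double has the
      same split form as \<open>M\<close>.\<close>
    obtain S where S: "S \<in> carrier_mat m m" "transpose_mat S = S" "S * S = 1\<^sub>m m" "a * S = S * transpose_mat a"
      using jordan_symmetric_intertwiner[of ms \<mu>] unfolding a_def m_def by blast
    note W1 = wonenburger_blocks_of_symmetric_intertwiner[OF a S va[unfolded x_def]]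
    define M1 where "M1 = four_block_mat a (mat_poly p a * S) (S * mat_poly p a) (transpose_mat a)"
    note d = wonenburger_blocks_diamond[OF W1, folded M1_def aa m_def, folded n[folded m_def]]
    have sim2: "similar_mat (jordan \<mu> (ms @ ms)) (jordan \<mu> (ms @ ms))"
      by (rule similar_mat_refl[OF jordan_carrier])
    have "symplectically_similar n (diamond_power M1 2) (hyp_mat p (jordan \<mu> (ms @ ms)))"
      unfolding d(2) by (rule split[OF d(1) sim2])
    moreover have "symplectically_similar n (hyp_mat p ?J) (hyp_mat p (jordan \<mu> (ms @ ms)))"
      by (rule hyp_mat_similar[OF J jordan_permute[OF ms']])
    ultimately have "symplectically_similar n M (diamond_power M1 2)"
      using symplectically_similar_trans[OF MJ] symplectically_similar_trans symplectically_similar_sym by blast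
    moreover have "wonenburger (n div 2) M1"
      unfolding wonenburger_iff_blocks using W1 n by (auto simp: M1_def m_def)
    ultimately show "even n \<and> (\<exists>M\<^sub>1. wonenburger (n div 2) M\<^sub>1 \<and> symplectically_similar n M (diamond_power M\<^sub>1 2))"
      using n by auto
  next
    assume "even n \<and> (\<exists>M\<^sub>1. wonenburger (n div 2) M\<^sub>1 \<and> symplectically_similar n M (diamond_power M\<^sub>1 2))"
    then obtain M1 where "even n" and M1: "wonenburger (n div 2) M1" "symplectically_similar n M (diamond_power M1 2)"
      by blast
    define m where "m = n div 2"
    have n: "n = m + m" using \<open>even n\<close> by (auto simp: m_def)
    obtain A B C where W: "wonenburger_blocks m A B C" and M1_eq: "M1 = four_block_mat A B C (transpose_mat A)"
      using M1(1) unfolding wonenburger_iff_blocks m_def by blast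
    note A = wonenburger_blocksD(1)[OF W]
    define D where "D X = four_block_mat X (0\<^sub>m m m) (0\<^sub>m m m) X" for X :: "real mat"
    note d = wonenburger_blocks_diamond[OF W, folded D_def M1_eq n]
    note DA = wonenburger_blocksD(1)[OF d(1)]
    have "similar_mat (diamond_power M1 2) M"
      using M1(2) unfolding symplectically_similar_def similar_mat_def by blast
    moreover have "diamond_power M1 2 \<in> carrier_mat (n + n) (n + n)"
      unfolding d(2) using DA by (intro four_block_carrier_mat) auto
    ultimately have "spectrum (map_mat complex_of_real (diamond_power M1 2)) \<subseteq>
        {complex_of_real l, complex_of_real (inverse l)}"
      using spectrum_of_real_similar assms(4) by blast
    then obtain ks where sim: "similar_mat (D A) (jordan \<mu> ks)"
      using jordan[OF d(1)] unfolding d(2) by blast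
    note v = vanish[OF sim _ dim[OF sim DA]]
    \<comment> \<open>\<open>?k\<close> squares to \<open>- (A + p(A))\<close>, and the quarter turn that combines two copies of it supplies
      the missing sign.\<close>
    let ?k = "mat_poly k A"
    let ?Y = "four_block_mat (0\<^sub>m m m) (- ?k) ?k (0\<^sub>m m m)"
    have ck: "?k \<in> carrier_mat m m" "mat_poly (x + p) A \<in> carrier_mat m m" using mat_poly_carrier[OF A] by blast+
    have Dk: "four_block_mat (mat_poly (k * k - - (x + p)) A) (0\<^sub>m m m) (0\<^sub>m m m)
        (mat_poly (k * k - - (x + p)) A) = 0\<^sub>m n n" (is "?D = _")
      using v[OF k_dvd] unfolding D_def mat_poly_diag_block[OF A A] .
    have k0: "mat_poly (k * k - - (x + p)) A $$ (i, j) = 0" if "i < m" "j < m" for i j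
    proof -
      have "mat_poly (k * k - - (x + p)) A $$ (i, j) = ?D $$ (i, j)" using that A by simp
      also have "\<dots> = 0" unfolding Dk using that n by simp
      finally show ?thesis .
    qed
    have kk: "- (?k * ?k) = mat_poly (x + p) A"
    proof -
      have "mat_poly (k * k - - (x + p)) A = ?k * ?k + mat_poly (x + p) A"
        by (simp only: diff_minus_eq_add mat_poly_add[OF A, of "k * k"] mat_poly_mult[OF A])
      then have sum0: "(?k * ?k) $$ (i, j) + mat_poly (x + p) A $$ (i, j) = 0" if "i < m" "j < m" for i j
        using k0[OF that] that ck A by (simp del: index_mult_mat(1))
      show ?thesis
      proof (rule eq_matI)
        fix i j assume "i < dim_row (mat_poly (x + p) A)" "j < dim_col (mat_poly (x + p) A)"
        then have ij: "i < m" "j < m" using A by auto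
        have "(- (?k * ?k)) $$ (i, j) = - ((?k * ?k) $$ (i, j))"
          using ij ck(1) A by (simp del: index_mult_mat(1))
        also have "\<dots> = mat_poly (x + p) A $$ (i, j)" using sum0[OF ij] by linarith
        finally show "(- (?k * ?k)) $$ (i, j) = mat_poly (x + p) A $$ (i, j)" .
      qed (use A in auto)
    qed
    have "?Y * ?Y = four_block_mat (- (?k * ?k)) (0\<^sub>m m m) (0\<^sub>m m m) (- (?k * ?k))"
      unfolding mult_four_block_mat[OF zero_carrier_mat uminus_carrier_mat[OF ck(1)] ck(1) zero_carrier_mat
        zero_carrier_mat uminus_carrier_mat[OF ck(1)] ck(1) zero_carrier_mat]
      using A by (intro cong_four_block_mat) (auto intro!: eq_matI)
    also have "\<dots> = mat_poly (x + p) (D A)"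
      unfolding kk D_def mat_poly_diag_block[OF A A] ..
    finally have YY: "?Y * ?Y = mat_poly (x + p) (D A)" .
    have Y: "?Y \<in> carrier_mat n n" unfolding n using ck by (intro four_block_carrier_mat) auto
    obtain X where X: "symplectic_sqrt n (hyp_mat p (D A)) X"
      using sqrt_hyp_matI[OF DA v[OF p_dvd[unfolded x_def]] Y YY[unfolded x_def]] by blast
    have "symplectically_similar n M (hyp_mat p (D A))"
      by (rule symplectically_similar_trans[OF M1(2)]) (unfold d(2), rule split[OF d(1) sim])
    from symplectic_sqrt_transfer[OF symplectically_similar_sym[OF this] X]
    show "\<exists>X. symplectic_sqrt n M X" .
  qed
qed

end
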